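(* Let $\mathcal V$ be a congruence modular variety with a $(2)$-dimensional Kiss term $q_2$, and for $n\ge3$ let $q_n$ be the $2^n$-ary terms defined recursively by $$q_n(x_0,\dots,x_{2^n-1})=q_2\big(q_{n-1}(x_0,\dots,x_{2^{n-1}-1}),\,x_{2^{n-1}-1},\,q_{n-1}(x_{2^{n-1}},\dots,x_{2^n-1}),\,x_{2^n-1}\big).$$ Let $\mathbb A\in\mathcal V$, $n\ge2$ and $\theta_0,\dots,\theta_{n-1}\in\mathrm{Con}(\mathbb A)$. For $\gamma\in A^{2^n}$ let $\widehat\gamma\in A^{2^n}$ be given by $\widehat\gamma_f=\gamma_f$ for $f\neq\mathbf 1$ and $\widehat\gamma_{\mathbf 1}=q_n(\gamma_{f_0},\gamma_{f_1},\dots,\gamma_{f_{2^n-1}})$, where $f_m\in 2^n$ is the function with $\sum_{i\in n}f_m(i)2^i=m$ (colexicographic order). If $\gamma\in A^{2^n}$ satisfies $\mathrm{face}_i^j(\gamma)\in\Delta(\{\theta_k\}_{k\in n\setminus\{i\}})$ for every $i\in n$ and $j\in 2$, then $\widehat\gamma\in\Delta(\theta_0,\dots,\theta_{n-1})$.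
   Context: Cube notation. $n=\{0,\dots,n-1\}$, $2=\{0,1\}$; for finite $S\subseteq\mathbb N$, $2^S$ is the set of functions $S\to2$, $\mathbf 1$ the constant function $1$; an $(S)$-cube over $A$ is $\gamma\in A^{2^S}$. For $i\in S$, $j\in 2$: $\mathrm{face}_i^j(\gamma)\in A^{2^{S\setminus\{i\}}}$ is $g\mapsto\gamma_{g\cup\{(i,j)\}}$; $\mathrm{face}_i(R)=\{(\mathrm{face}_i^0\gamma,\mathrm{face}_i^1\gamma):\gamma\in R\}$; $\mathrm{glue}_{\{i\}}(\zeta,\eta)$ is the cube with $\mathrm{face}_i^0=\zeta$, $\mathrm{face}_i^1=\eta$; $\mathrm{refl}_i^j(\gamma)=\mathrm{glue}_{\{i\}}(\mathrm{face}_i^j\gamma,\mathrm{face}_i^j\gamma)$; $\mathrm{sym}_i(\gamma)=\mathrm{glue}_{\{i\}}(\mathrm{face}_i^1\gamma,\mathrm{face}_i^0\gamma)$; $\mathrm{cube}_i(x,y)$ has value $x$ where $f(i)=0$ and $y$ where $f(i)=1$. Cubes indexed by a one-element set are identified with pairs. A subuniverse $R\le\mathbb A^{2^S}$ is an $(|S|)$-dimensional congruence of $\mathbb A$ if $\mathrm{refl}_i^j(\gamma),\mathrm{sym}_i(\gamma)\in R$ for all $\gamma\in R$, $i\in S$, $j\in 2$, and each $\mathrm{face}_i(R)$ is transitive. For $\theta_k\in\mathrm{Con}(\mathbb A)$ ($k\in S$), $\Delta(\{\theta_k\}_{k\in S})$ is the smallest $(|S|)$-dimensional congruence of $\mathbb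 A$ containing the subuniverse $M(\{\theta_k\}_{k\in S})$ of $\mathbb A^{2^S}$ generated by all $\mathrm{cube}_k(x,y)$ with $k\in S$, $(x,y)\in\theta_k$; for $S=n$ write $\Delta(\theta_0,\dots,\theta_{n-1})$; for $|S|=1$, $\Delta(\theta)=\theta$. Squares and $\mathrm{Rect}$. For $\alpha,\beta\in\mathrm{Con}(\mathbb A)$, $\mathrm{Rect}(\alpha,\beta)$ is the set of $\gamma\in A^{2^2}$ with $(\gamma_{00},\gamma_{10}),(\gamma_{01},\gamma_{11})\in\alpha$ and $(\gamma_{00},\gamma_{01}),(\gamma_{10},\gamma_{11})\in\beta$, where $\gamma_{ab}$ is the value at $f$ with $f(0)=a,f(1)=b$. The binary term condition commutator $[\alpha,\beta]_{TC}$ is the least $\delta$ such that for each $\gamma\in M(\alpha,\beta)$ and $i\in 2$, if the $i$-direction line of $\gamma$ not containing $\gamma_{11}$ lies in $\delta$ then so does the $i$-direction line containing $\gamma_{11}$. Kiss term. A $4$-ary term $q_2$ is a $(2)$-dimensional Kiss term for $\mathcal V$ if $q_2(x,x,y,y)\approx q_2(x,y,x,y)\approx y$ in $\mathcal V$ and for all $\mathbb A\in\mathcal V$, $\alpha,\beta\in\mathrm{Con}(\mathbb A)$, whenever the squares $(\gamma_{00},\gamma_{10},\gamma_{01},\gamma_{11})=(a,b,c,d)$ and $(a,b,c,d')$ lie in $\mathrm{Rect}(\alpha,\beta)$, $(q_2(a,b,c,d),q_2(a,b,c,d'))\in[\alpha,\beta]_{TC}$. Every congruence modular variety has a $(2)$-dimensional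 Kiss term (Kiss). *)

theory Defs
  imports "HOL-Library.FuncSet"
begin

text \<open>An algebra of signature ar (arity function on operation symbols 'f) is given by a
carrier B and an interpretation G of the operation symbols (applied to argument lists).\<close>

datatype 'f trm = Var nat | Fn 'f "'f trm list"

fun wf_trm :: "('f \<Rightarrow> nat) \<Rightarrow> 'f trm \<Rightarrow> bool" where
  "wf_trm ar (Var i) = True"
| "wf_trm ar (Fn f ts) = (length ts = ar f \<and> (\<forall>t\<in>set ts. wf_trm ar t))"

fun vars :: "'f trm \<Rightarrow> nat set" where
  "vars (Var i) = {i}"
| "vars (Fn f ts) = (\<Union>t\<in>set ts. vars t)"

fun tev :: "('f \<Rightarrow> 'a list \<Rightarrow> 'a) \<Rightarrow> (nat \<Rightarrow> 'a) \<Rightarrow> 'f trm \<Rightarrow> 'a" where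
  "tev G \<rho> (Var i) = \<rho> i"
| "tev G \<rho> (Fn f ts) = G f (map (tev G \<rho>) ts)"

fun tsubst :: "(nat \<Rightarrow> 'f trm) \<Rightarrow> 'f trm \<Rightarrow> 'f trm" where
  "tsubst \<sigma> (Var i) = \<sigma> i"
| "tsubst \<sigma> (Fn f ts) = Fn f (map (tsubst \<sigma>) ts)"

definition evl :: "('f \<Rightarrow> 'a list \<Rightarrow> 'a) \<Rightarrow> 'a list \<Rightarrow> 'f trm \<Rightarrow> 'a" where
  "evl G xs t = tev G (\<lambda>i. xs ! i) t"

definition is_alg :: "('f \<Rightarrow> nat) \<Rightarrow> 'a set \<Rightarrow> ('f \<Rightarrow> 'a list \<Rightarrow> 'a) \<Rightarrow> bool" where
  "is_alg ar B G \<longleftrightarrow> B \<noteq> {} \<and>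
     (\<forall>f xs. length xs = ar f \<and> set xs \<subseteq> B \<longrightarrow> G f xs \<in> B)"

text \<open>The variety V is represented by its defining set of identities E (Birkhoff).\<close>
definition in_variety ::
  "('f \<Rightarrow> nat) \<Rightarrow> ('f trm \<times> 'f trm) set \<Rightarrow> 'a set \<Rightarrow> ('f \<Rightarrow> 'a list \<Rightarrow> 'a) \<Rightarrow> bool" where
  "in_variety ar E B G \<longleftrightarrow> is_alg ar B G \<and>
     (\<forall>(s, t)\<in>E. \<forall>\<rho>. (\<forall>i. \<rho> i \<in> B) \<longrightarrow> tev G \<rho> s = tev G \<rho> t)"

definition is_con :: "('f \<Rightarrow> nat) \<Rightarrow> 'a set \<Rightarrow> ('f \<Rightarrow> 'a list \<Rightarrow> 'a) \<Rightarrow> 'a rel \<Rightarrow> bool" where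
  "is_con ar B G \<theta> \<longleftrightarrow> equiv B \<theta> \<and>
     (\<forall>f xs ys. length xs = ar f \<and> length ys = ar f \<and> set xs \<subseteq> B \<and> set ys \<subseteq> B \<and>
        list_all2 (\<lambda>x y. (x, y) \<in> \<theta>) xs ys \<longrightarrow> (G f xs, G f ys) \<in> \<theta>)"

definition con_join :: "('f \<Rightarrow> nat) \<Rightarrow> 'a set \<Rightarrow> ('f \<Rightarrow> 'a list \<Rightarrow> 'a) \<Rightarrow> 'a rel \<Rightarrow> 'a rel \<Rightarrow> 'a rel" where
  "con_join ar B G \<alpha> \<beta> = \<Inter>{\<theta>. is_con ar B G \<theta> \<and> \<alpha> \<union> \<beta> \<subseteq> \<theta>}"

definition cong_modular_var :: "('f \<Rightarrow> nat) \<Rightarrow> ('f trm \<times> 'f trm) set \<Rightarrow> 'b itself \<Rightarrow> bool" where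
  "cong_modular_var ar E (_::'b itself) \<longleftrightarrow>
     (\<forall>(B::'b set) G. in_variety ar E B G \<longrightarrow>
        (\<forall>\<alpha> \<beta> \<gamma>. is_con ar B G \<alpha> \<and> is_con ar B G \<beta> \<and> is_con ar B G \<gamma> \<and> \<alpha> \<subseteq> \<gamma> \<longrightarrow>
           con_join ar B G \<alpha> \<beta> \<inter> \<gamma> = con_join ar B G \<alpha> (\<beta> \<inter> \<gamma>)))"

definition pw_op :: "('f \<Rightarrow> 'a list \<Rightarrow> 'a) \<Rightarrow> 'i set \<Rightarrow> 'f \<Rightarrow> ('i \<Rightarrow> 'a) list \<Rightarrow> 'i \<Rightarrow> 'a" where
  "pw_op G I f xs = (\<lambda>i\<in>I. G f (map (\<lambda>x. x i) xs))"

definition is_subuniv_pow ::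
  "('f \<Rightarrow> nat) \<Rightarrow> 'a set \<Rightarrow> ('f \<Rightarrow> 'a list \<Rightarrow> 'a) \<Rightarrow> 'i set \<Rightarrow> ('i \<Rightarrow> 'a) set \<Rightarrow> bool" where
  "is_subuniv_pow ar B G I R \<longleftrightarrow> R \<subseteq> (I \<rightarrow>\<^sub>E B) \<and>
     (\<forall>f xs. length xs = ar f \<and> set xs \<subseteq> R \<longrightarrow> pw_op G I f xs \<in> R)"

definition gen_pow ::
  "('f \<Rightarrow> nat) \<Rightarrow> 'a set \<Rightarrow> ('f \<Rightarrow> 'a list \<Rightarrow> 'a) \<Rightarrow> 'i set \<Rightarrow> ('i \<Rightarrow> 'a) set \<Rightarrow> ('i \<Rightarrow> 'a) set" where
  "gen_pow ar B G I X = \<Inter>{R. is_subuniv_pow ar B G I R \<and> X \<subseteq> R}"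

text \<open>2^S is the set of functions S -> {0,1} (extensional: undefined outside S);
an (S)-cube over B is an element of 2^S ->E B.\<close>
definition cubes :: "nat set \<Rightarrow> (nat \<Rightarrow> nat) set" where
  "cubes S = S \<rightarrow>\<^sub>E {0, 1}"

definition face :: "nat set \<Rightarrow> nat \<Rightarrow> nat \<Rightarrow> ((nat \<Rightarrow> nat) \<Rightarrow> 'a) \<Rightarrow> (nat \<Rightarrow> nat) \<Rightarrow> 'a" where
  "face S i j \<gamma> = (\<lambda>g\<in>cubes (S - {i}). \<gamma> (g(i := j)))"

definition face_rel :: "nat set \<Rightarrow> nat \<Rightarrow> ((nat \<Rightarrow> nat) \<Rightarrow> 'a) set
    \<Rightarrow> (((nat \<Rightarrow> nat) \<Rightarrow> 'a) \<times> ((nat \<Rightarrow> nat) \<Rightarrow> 'a)) set" where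
  "face_rel S i R = {(face S i 0 \<gamma>, face S i 1 \<gamma>) | \<gamma>. \<gamma> \<in> R}"

definition glue :: "nat set \<Rightarrow> nat \<Rightarrow> ((nat \<Rightarrow> nat) \<Rightarrow> 'a) \<Rightarrow> ((nat \<Rightarrow> nat) \<Rightarrow> 'a) \<Rightarrow> (nat \<Rightarrow> nat) \<Rightarrow> 'a" where
  "glue S i \<zeta> \<eta> = (\<lambda>f\<in>cubes S. if f i = 0 then \<zeta> (f(i := undefined)) else \<eta> (f(i := undefined)))"

definition refl_c :: "nat set \<Rightarrow> nat \<Rightarrow> nat \<Rightarrow> ((nat \<Rightarrow> nat) \<Rightarrow> 'a) \<Rightarrow> (nat \<Rightarrow> nat) \<Rightarrow> 'a" where
  "refl_c S i j \<gamma> = glue S i (face S i j \<gamma>) (face S i j \<gamma>)"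

definition sym_c :: "nat set \<Rightarrow> nat \<Rightarrow> ((nat \<Rightarrow> nat) \<Rightarrow> 'a) \<Rightarrow> (nat \<Rightarrow> nat) \<Rightarrow> 'a" where
  "sym_c S i \<gamma> = glue S i (face S i 1 \<gamma>) (face S i 0 \<gamma>)"

definition cube :: "nat set \<Rightarrow> nat \<Rightarrow> 'a \<Rightarrow> 'a \<Rightarrow> (nat \<Rightarrow> nat) \<Rightarrow> 'a" where
  "cube S i x y = (\<lambda>f\<in>cubes S. if f i = 0 then x else y)"

definition dimcon :: "('f \<Rightarrow> nat) \<Rightarrow> 'a set \<Rightarrow> ('f \<Rightarrow> 'a list \<Rightarrow> 'a) \<Rightarrow> nat set
    \<Rightarrow> ((nat \<Rightarrow> nat) \<Rightarrow> 'a) set \<Rightarrow> bool" where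
  "dimcon ar B G S R \<longleftrightarrow> is_subuniv_pow ar B G (cubes S) R \<and>
     (\<forall>\<gamma>\<in>R. \<forall>i\<in>S. (\<forall>j\<in>{0, 1}. refl_c S i j \<gamma> \<in> R) \<and> sym_c S i \<gamma> \<in> R) \<and>
     (\<forall>i\<in>S. trans (face_rel S i R))"

definition Mgen :: "('f \<Rightarrow> nat) \<Rightarrow> 'a set \<Rightarrow> ('f \<Rightarrow> 'a list \<Rightarrow> 'a) \<Rightarrow> nat set
    \<Rightarrow> (nat \<Rightarrow> 'a rel) \<Rightarrow> ((nat \<Rightarrow> nat) \<Rightarrow> 'a) set" where
  "Mgen ar B G S \<theta> =
     gen_pow ar B G (cubes S) {cube S k x y | k x y. k \<in> S \<and> (x, y) \<in> \<theta> k}"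

definition Delta :: "('f \<Rightarrow> nat) \<Rightarrow> 'a set \<Rightarrow> ('f \<Rightarrow> 'a list \<Rightarrow> 'a) \<Rightarrow> nat set
    \<Rightarrow> (nat \<Rightarrow> 'a rel) \<Rightarrow> ((nat \<Rightarrow> nat) \<Rightarrow> 'a) set" where
  "Delta ar B G S \<theta> = \<Inter>{R. dimcon ar B G S R \<and> Mgen ar B G S \<theta> \<subseteq> R}"

definition sqv :: "((nat \<Rightarrow> nat) \<Rightarrow> 'a) \<Rightarrow> nat \<Rightarrow> nat \<Rightarrow> 'a" where
  "sqv \<gamma> a b = \<gamma> ((\<lambda>_. undefined)(0 := a, 1 := b))"

text \<open>The square (gamma_00, gamma_10, gamma_01, gamma_11) = (a, b, c, d).\<close>
definition mk_sq :: "'a \<Rightarrow> 'a \<Rightarrow> 'a \<Rightarrow> 'a \<Rightarrow> (nat \<Rightarrow> nat) \<Rightarrow> 'a" where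
  "mk_sq a b c d = (\<lambda>f\<in>cubes {0, 1}.
      if f 0 = 0 \<and> f 1 = 0 then a else if f 1 = 0 then b else if f 0 = 0 then c else d)"

definition Rect :: "'a set \<Rightarrow> 'a rel \<Rightarrow> 'a rel \<Rightarrow> ((nat \<Rightarrow> nat) \<Rightarrow> 'a) set" where
  "Rect B \<alpha> \<beta> = {\<gamma> \<in> cubes {0, 1} \<rightarrow>\<^sub>E B.
      (sqv \<gamma> 0 0, sqv \<gamma> 1 0) \<in> \<alpha> \<and> (sqv \<gamma> 0 1, sqv \<gamma> 1 1) \<in> \<alpha> \<and>
      (sqv \<gamma> 0 0, sqv \<gamma> 0 1) \<in> \<beta> \<and> (sqv \<gamma> 1 0, sqv \<gamma> 1 1) \<in> \<beta>}"

definition TC_comm :: "('f \<Rightarrow> nat) \<Rightarrow> 'a set \<Rightarrow> ('f \<Rightarrow> 'a list \<Rightarrow> 'a) \<Rightarrow> 'a rel \<Rightarrow> 'a rel \<Rightarrow> 'a rel" where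
  "TC_comm ar B G \<alpha> \<beta> = \<Inter>{\<delta>. is_con ar B G \<delta> \<and>
     (\<forall>\<gamma>\<in>Mgen ar B G {0, 1} (\<lambda>k. if k = 0 then \<alpha> else \<beta>).
        ((sqv \<gamma> 0 0, sqv \<gamma> 1 0) \<in> \<delta> \<longrightarrow> (sqv \<gamma> 0 1, sqv \<gamma> 1 1) \<in> \<delta>) \<and>
        ((sqv \<gamma> 0 0, sqv \<gamma> 0 1) \<in> \<delta> \<longrightarrow> (sqv \<gamma> 1 0, sqv \<gamma> 1 1) \<in> \<delta>))}"

definition kiss_term :: "('f \<Rightarrow> nat) \<Rightarrow> ('f trm \<times> 'f trm) set \<Rightarrow> 'f trm \<Rightarrow> 'b itself \<Rightarrow> bool" where
  "kiss_term ar E q (_::'b itself) \<longleftrightarrow> wf_trm ar q \<and> vars q \<subseteq> {0..<4} \<and>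
     (\<forall>(B::'b set) G. in_variety ar E B G \<longrightarrow>
        (\<forall>x\<in>B. \<forall>y\<in>B. evl G [x, x, y, y] q = y \<and> evl G [x, y, x, y] q = y) \<and>
        (\<forall>\<alpha> \<beta>. is_con ar B G \<alpha> \<and> is_con ar B G \<beta> \<longrightarrow>
           (\<forall>a b c d d'. mk_sq a b c d \<in> Rect B \<alpha> \<beta> \<and> mk_sq a b c d' \<in> Rect B \<alpha> \<beta> \<longrightarrow>
              (evl G [a, b, c, d] q, evl G [a, b, c, d'] q) \<in> TC_comm ar B G \<alpha> \<beta>)))"

definition qsub :: "'f trm \<Rightarrow> 'f trm \<Rightarrow> 'f trm \<Rightarrow> 'f trm \<Rightarrow> nat \<Rightarrow> 'f trm" where
  "qsub a b c d i = (if i = 0 then a else if i = 1 then b else if i = 2 then c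
                     else if i = 3 then d else Var i)"

text \<open>qterm q2 n is q_n for n >= 2 (q_2 = q2; values for n < 2 are irrelevant).\<close>
fun qterm :: "'f trm \<Rightarrow> nat \<Rightarrow> 'f trm" where
  "qterm q 0 = q"
| "qterm q (Suc n) = (if Suc n \<le> 2 then q else
     tsubst (qsub (qterm q n) (Var (2 ^ n - 1))
                  (tsubst (\<lambda>j. Var (j + 2 ^ n)) (qterm q n)) (Var (2 ^ Suc n - 1))) q)"

definition fcolex :: "nat \<Rightarrow> nat \<Rightarrow> nat \<Rightarrow> nat" where
  "fcolex n m = (\<lambda>i\<in>{0..<n}. m div 2 ^ i mod 2)"

definition one_c :: "nat \<Rightarrow> nat \<Rightarrow> nat" where
  "one_c n = (\<lambda>i\<in>{0..<n}. 1)"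

definition hat :: "('f \<Rightarrow> 'a list \<Rightarrow> 'a) \<Rightarrow> 'f trm \<Rightarrow> nat \<Rightarrow> ((nat \<Rightarrow> nat) \<Rightarrow> 'a) \<Rightarrow> (nat \<Rightarrow> nat) \<Rightarrow> 'a" where
  "hat G q n \<gamma> = \<gamma>(one_c n := evl G (map (\<lambda>m. \<gamma> (fcolex n m)) [0..<2 ^ n]) (qterm q n))"

end

theory Submission
  imports Defs
begin

text \<open>
  Everything takes place inside \<open>\<Delta> = \<Delta>(\<theta>\<^sub>0, \<dots>, \<theta>\<^sub>n\<^sub>-\<^sub>1)\<close>: a face of \<open>\<gamma>\<close> lies in
  the lower-dimensional \<open>\<Delta>\<close> only if its degenerate extension lies in \<open>\<Delta>\<close>. By induction on \<open>m\<close>,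
  applying \<open>q\<^sub>m\<close> to all faces of \<open>\<gamma>\<close> in the first \<open>m\<close> directions gives a cube of \<open>\<Delta>\<close>, where
  \<open>q\<^sub>1\<close> is the first projection. The step concerns only direction \<open>0\<close> and the new direction, so it
  is a statement about a two-dimensional congruence \<open>D\<close>, with edge congruences \<open>\<phi>\<close> and \<open>\<psi>\<close>, on the
  algebra of cubes that are constant in both directions: if \<open>(a, b, c, d) \<in> Rect(\<phi>, \<psi>)\<close>, then
  \<open>(a, b, c, q\<^sub>2(a, b, c, d)) \<in> D\<close>.

  For this, view \<open>D\<close> as a congruence \<open>\<delta>\<close> on the algebra \<open>\<phi>\<close> of pairs. Let \<open>\<psi>\<^sub>0\<close> relate pairs with
  \<open>\<psi>\<close>-related first components and \<open>\<psi>\<^sub>1\<close> pairs with \<open>\<psi>\<close>-related components. Then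
  \<open>[\<psi>\<^sub>0, \<psi>\<^sub>1] \<subseteq> \<delta>\<close>: one of the two term conditions is a diagram chase, and the other follows by
  applying the shifting lemma twice in the algebra \<open>\<psi>\<^sub>1\<close>. The Kiss property now gives
  \<open>(c, q\<^sub>2(a, b, c, d)) = q\<^sub>2((a, a), (a, b), (c, c), (c, d)) \<delta> q\<^sub>2((a, a), (a, b), (a, a), (c, d))
  \<delta> q\<^sub>2((a, a), (a, b), (a, a), (a, b)) = (a, b)\<close>.
\<close>

subsection \<open>Terms, congruences and algebras of pairs\<close>

lemma tev_hom:
  assumes "\<And>f xs. h (G f xs) = G' f (map h xs)"
  shows "h (tev G \<rho> t) = tev G' (\<lambda>i. h (\<rho> i)) t"
  by (induction t) (simp_all add: assms o_def cong: map_cong)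

lemma tev_cong:
  assumes "\<And>i. i \<in> vars t \<Longrightarrow> \<rho> i = \<rho>' i"
  shows "tev G \<rho> t = tev G \<rho>' t"
  using assms
proof (induction t)
  case (Fn f ts)
  then have "map (tev G \<rho>) ts = map (tev G \<rho>') ts"
    by (intro map_cong) auto
  then show ?case by (simp only: tev.simps)
qed simp

lemma tev_tsubst: "tev G \<rho> (tsubst \<sigma> t) = tev G (\<lambda>i. tev G \<rho> (\<sigma> i)) t"
  by (induction t) (simp_all add: o_def cong: map_cong)

lemma vars_tsubst: "vars (tsubst \<sigma> t) = (\<Union>i\<in>vars t. vars (\<sigma> i))"
  by (induction t) auto

lemma is_conI:
  assumes "\<theta> \<subseteq> B \<times> B" "\<And>x. x \<in> B \<Longrightarrow> (x, x) \<in> \<theta>" "sym \<theta>" "trans \<theta>"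
    and "\<And>f xs ys. length xs = ar f \<Longrightarrow> length ys = ar f \<Longrightarrow>
      list_all2 (\<lambda>x y. (x, y) \<in> \<theta>) xs ys \<Longrightarrow> (G f xs, G f ys) \<in> \<theta>"
  shows "is_con ar B G \<theta>"
  using assms unfolding is_con_def equiv_def refl_on_def by auto

lemma is_con_dom: "is_con ar B G \<theta> \<Longrightarrow> (x, y) \<in> \<theta> \<Longrightarrow> x \<in> B \<and> y \<in> B"
  unfolding is_con_def equiv_def by auto

lemma is_con_refl: "is_con ar B G \<theta> \<Longrightarrow> x \<in> B \<Longrightarrow> (x, x) \<in> \<theta>"
  unfolding is_con_def equiv_def refl_on_def by auto

lemma is_con_sym: "is_con ar B G \<theta> \<Longrightarrow> (x, y) \<in> \<theta> \<Longrightarrow> (y, x) \<in> \<theta>"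
  unfolding is_con_def equiv_def sym_def by auto

lemma is_con_trans: "is_con ar B G \<theta> \<Longrightarrow> (x, y) \<in> \<theta> \<Longrightarrow> (y, z) \<in> \<theta> \<Longrightarrow> (x, z) \<in> \<theta>"
  unfolding is_con_def equiv_def trans_def by blast

lemma list_all2_in_Times:
  assumes "list_all2 (\<lambda>x y. (x, y) \<in> R) xs ys" "R \<subseteq> P \<times> Q"
  shows "set xs \<subseteq> P" "set ys \<subseteq> Q"
  using assms by (induction rule: list_all2_induct) auto

lemma is_con_compat:
  assumes "is_con ar B G \<theta>" "length xs = ar f" "list_all2 (\<lambda>x y. (x, y) \<in> \<theta>) xs ys"
  shows "(G f xs, G f ys) \<in> \<theta>"
proof -
  have "length ys = ar f" using assms by (auto dest: list_all2_lengthD)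
  moreover have "set xs \<subseteq> B" "set ys \<subseteq> B"
    using list_all2_in_Times[OF assms(3)] assms(1) unfolding is_con_def equiv_def by metis+
  ultimately show ?thesis using assms unfolding is_con_def by blast
qed

lemma tev_con:
  assumes "is_con ar B G \<theta>" "wf_trm ar t" "\<And>i. i \<in> vars t \<Longrightarrow> (\<rho> i, \<rho>' i) \<in> \<theta>"
  shows "(tev G \<rho> t, tev G \<rho>' t) \<in> \<theta>"
  using assms(2,3)
proof (induction t)
  case (Fn f ts)
  have "list_all2 (\<lambda>x y. (x, y) \<in> \<theta>) (map (tev G \<rho>) ts) (map (tev G \<rho>') ts)"
    using Fn by (auto simp: list_all2_map1 list_all2_map2 intro!: list.rel_refl_strong)
  then show ?case using is_con_compat[OF assms(1)] Fn.prems by simp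
qed simp

lemma evl_hom:
  assumes "\<And>f xs. h (G f xs) = G' f (map h xs)" "vars t \<subseteq> {0..<length xs}"
  shows "h (evl G xs t) = evl G' (map h xs) t"
  unfolding evl_def tev_hom[of h G G', OF assms(1)]
  using assms(2) by (intro tev_cong) auto

lemma evl_con:
  assumes "is_con ar B G \<theta>" "wf_trm ar t" "vars t \<subseteq> {0..<length xs}"
    "list_all2 (\<lambda>x y. (x, y) \<in> \<theta>) xs ys"
  shows "(evl G xs t, evl G ys t) \<in> \<theta>"
  unfolding evl_def using assms(3,4)
  by (intro tev_con[OF assms(1,2)]) (auto simp: list_all2_conv_all_nth)

lemma is_con_Int:
  assumes a: "is_con ar B G \<alpha>" and b: "is_con ar B G \<beta>"
  shows "is_con ar B G (\<alpha> \<inter> \<beta>)"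
proof (rule is_conI)
  show "\<alpha> \<inter> \<beta> \<subseteq> B \<times> B" using is_con_dom[OF a] by auto
  show "sym (\<alpha> \<inter> \<beta>)" using is_con_sym[OF a] is_con_sym[OF b] by (auto simp: sym_def)
  show "trans (\<alpha> \<inter> \<beta>)" using is_con_trans[OF a] is_con_trans[OF b] unfolding trans_def by blast
  fix f xs ys assume "length xs = ar f" "length ys = ar f" 
    "list_all2 (\<lambda>x y. (x, y) \<in> \<alpha> \<inter> \<beta>) xs ys"
  then show "(G f xs, G f ys) \<in> \<alpha> \<inter> \<beta>"
    using is_con_compat[OF a, of xs f ys] is_con_compat[OF b, of xs f ys]
    by (auto simp: list_all2_conv_all_nth)
qed (use is_con_refl[OF a] is_con_refl[OF b] in auto)

lemma is_con_Id_on: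
  assumes "is_alg ar B G"
  shows "is_con ar B G (Id_on B)"
proof (rule is_conI)
  fix f xs ys assume *: "length xs = ar f" "length ys = ar f"
    "list_all2 (\<lambda>x y. (x, y) \<in> Id_on B) xs ys"
  then have "xs = ys" by (auto simp: list_all2_conv_all_nth Id_on_iff intro: nth_equalityI)
  moreover have "set xs \<subseteq> B" using list_all2_in_Times[OF *(3)] by auto
  ultimately show "(G f xs, G f ys) \<in> Id_on B" using assms * unfolding is_alg_def by auto
qed (auto simp: sym_def trans_def)

section \<open>Pullbacks of congruences, algebras of pairs, and transport along injections\<close>

definition pull :: "'b set \<Rightarrow> ('b \<Rightarrow> 'a) \<Rightarrow> 'a rel \<Rightarrow> 'b rel" where
  "pull R h \<theta> = {(u, v). u \<in> R \<and> v \<in> R \<and> (h u, h v) \<in> \<theta>}"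

lemma is_con_pull:
  assumes c: "is_con ar B G \<theta>" and a: "is_alg ar R G'" and R: "h ` R \<subseteq> B"
    and hom: "\<And>f xs. h (G' f xs) = G f (map h xs)"
  shows "is_con ar R G' (pull R h \<theta>)"
proof (rule is_conI)
  show "sym (pull R h \<theta>)" using is_con_sym[OF c] unfolding pull_def sym_def by blast
  show "trans (pull R h \<theta>)" using is_con_trans[OF c] unfolding pull_def trans_def by blast
  fix f xs ys assume *: "length xs = ar f" "length ys = ar f"
    "list_all2 (\<lambda>x y. (x, y) \<in> pull R h \<theta>) xs ys"
  then have "set xs \<subseteq> R" "set ys \<subseteq> R"
    "list_all2 (\<lambda>x y. (x, y) \<in> \<theta>) (map h xs) (map h ys)"
    by (auto simp: list_all2_conv_all_nth in_set_conv_nth pull_def)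
  then show "(G' f xs, G' f ys) \<in> pull R h \<theta>"
    using a * is_con_compat[OF c, of "map h xs" f "map h ys"]
    unfolding pull_def is_alg_def by (auto simp: hom)
qed (use R is_con_refl[OF c] in \<open>auto simp: pull_def\<close>)

definition pair_op :: "('f \<Rightarrow> 'a list \<Rightarrow> 'a) \<Rightarrow> 'f \<Rightarrow> ('a \<times> 'a) list \<Rightarrow> 'a \<times> 'a" where
  "pair_op G f xs = (G f (map fst xs), G f (map snd xs))"

lemma fst_pair_op: "fst (pair_op G f xs) = G f (map fst xs)"
  and snd_pair_op: "snd (pair_op G f xs) = G f (map snd xs)"
  by (simp_all add: pair_op_def)

lemma in_varietyD:
  assumes "in_variety ar E B G" "(s, t) \<in> E" "\<And>i. \<rho> i \<in> B"
  shows "tev G \<rho> s = tev G \<rho> t"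
  using assms unfolding in_variety_def by auto

text \<open>A congruence is a subalgebra of the square of the algebra, and both projections are
  homomorphisms, so identities can be checked in each component. Applied twice, this also puts
  algebras of pairs of pairs into the variety.\<close>

lemma in_variety_con:
  assumes v: "in_variety ar E B G" and c: "is_con ar B G \<theta>"
  shows "in_variety ar E \<theta> (pair_op G)"
  unfolding in_variety_def
proof (intro conjI)
  have "B \<noteq> {}" using v by (simp add: in_variety_def is_alg_def)
  then have "\<theta> \<noteq> {}" using is_con_refl[OF c] by fast
  moreover have "pair_op G f xs \<in> \<theta>" if "length xs = ar f" "set xs \<subseteq> \<theta>" for f xs
    unfolding pair_op_def using that
    by (intro is_con_compat[OF c]) (auto simp: list_all2_conv_all_nth)
  ultimately show "is_alg ar \<theta> (pair_op G)" unfolding is_alg_def by blast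
  show "\<forall>(s, t)\<in>E. \<forall>\<rho>. (\<forall>i. \<rho> i \<in> \<theta>) \<longrightarrow> tev (pair_op G) \<rho> s = tev (pair_op G) \<rho> t"
  proof safe
    fix s t and \<rho> :: "nat \<Rightarrow> _" assume E: "(s, t) \<in> E" and \<rho>: "\<forall>i. \<rho> i \<in> \<theta>"
    have *: "\<forall>i. fst (\<rho> i) \<in> B" "\<forall>i. snd (\<rho> i) \<in> B"
      using \<rho> is_con_dom[OF c] by (metis prod.collapse)+
    have "tev G (\<lambda>i. fst (\<rho> i)) s = tev G (\<lambda>i. fst (\<rho> i)) t"
      "tev G (\<lambda>i. snd (\<rho> i)) s = tev G (\<lambda>i. snd (\<rho> i)) t"
      using in_varietyD[OF v E] * by auto
    then show "tev (pair_op G) \<rho> s = tev (pair_op G) \<rho> t"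
      unfolding tev_hom[of fst "pair_op G" G, OF fst_pair_op, symmetric]
        tev_hom[of snd "pair_op G" G, OF snd_pair_op, symmetric]
      by (rule prod_eqI)
  qed
qed

text \<open>The isomorphic copy of an algebra under an injection \<open>h\<close>. Modularity and
  the Kiss property are assumed at fixed types, so an algebra over another type is moved to such a
  type before they are applied.\<close>

definition image_op :: "('a \<Rightarrow> 'b) \<Rightarrow> ('f \<Rightarrow> 'a list \<Rightarrow> 'a) \<Rightarrow> 'f \<Rightarrow> 'b list \<Rightarrow> 'b" where
  "image_op h G f xs = h (G f (map (inv h) xs))"

lemma image_op_hom: "inj h \<Longrightarrow> h (G f xs) = image_op h G f (map h xs)"
  by (simp add: image_op_def o_def)

lemma inv_image_op_hom: "inj h \<Longrightarrow> inv h (image_op h G f xs) = G f (map (inv h) xs)"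
  by (simp add: image_op_def)

lemma is_alg_image:
  assumes "is_alg ar B G" "inj h"
  shows "is_alg ar (h ` B) (image_op h G)"
  unfolding is_alg_def
proof (intro conjI allI impI)
  show "h ` B \<noteq> {}" using assms by (auto simp: is_alg_def)
  fix f xs assume *: "length xs = ar f \<and> set xs \<subseteq> h ` B"
  then have "set (map (inv h) xs) \<subseteq> B" using assms(2) by auto
  then show "image_op h G f xs \<in> h ` B"
    unfolding image_op_def using assms(1) * by (auto simp: is_alg_def)
qed

lemma in_variety_image:
  assumes v: "in_variety ar E B G" and h: "inj h"
  shows "in_variety ar E (h ` B) (image_op h G)"
  unfolding in_variety_def
proof (intro conjI)
  show "is_alg ar (h ` B) (image_op h G)" using v h by (simp add: in_variety_def is_alg_image)
  show "\<forall>(s, t)\<in>E. \<forall>\<rho>. (\<forall>i. \<rho> i \<in> h ` B) \<longrightarrow> tev (image_op h G) \<rho> s = tev (image_op h G) \<rho> t"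
  proof safe
    fix s t and \<rho> :: "nat \<Rightarrow> _" assume E: "(s, t) \<in> E" and \<rho>: "\<forall>i. \<rho> i \<in> h ` B"
    have "\<forall>i. inv h (\<rho> i) \<in> B" using \<rho> h by (metis imageE inv_f_f)
    then have "h (tev G (\<lambda>i. inv h (\<rho> i)) s) = h (tev G (\<lambda>i. inv h (\<rho> i)) t)"
      using v E unfolding in_variety_def by auto
    moreover have "h (inv h (\<rho> i)) = \<rho> i" for i
      using \<rho>[rule_format, of i] by (auto simp: f_inv_into_f)
    ultimately show "tev (image_op h G) \<rho> s = tev (image_op h G) \<rho> t"
      by (simp add: tev_hom[of h G "image_op h G", OF image_op_hom[OF h]])
  qed
qed

lemma is_con_image:
  assumes "is_con ar B G \<theta>" "is_alg ar B G" "inj h"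
  shows "is_con ar (h ` B) (image_op h G) (pull (h ` B) (inv h) \<theta>)"
  using assms by (intro is_con_pull[OF assms(1)] is_alg_image) (auto simp: inv_image_op_hom)

lemma pull_image_iff:
  assumes "is_con ar B G \<theta>" "inj h"
  shows "(h x, h y) \<in> pull (h ` B) (inv h) \<theta> \<longleftrightarrow> (x, y) \<in> \<theta>"
  using assms is_con_dom[OF assms(1)] by (auto simp: pull_def)

text \<open>Gumm's shifting lemma. The path \<open>c\<close>, \<open>a\<close>, \<open>b\<close>,
  \<open>d\<close> puts \<open>(c, d)\<close> into the join of
  \<open>\<gamma> \<inter> \<alpha>\<close> and \<open>\<beta>\<close>. As
  \<open>\<gamma> \<inter> \<alpha>\<close> lies below \<open>\<alpha>\<close>, modularity allows
  \<open>\<beta>\<close> to be replaced by \<open>\<beta> \<inter> \<alpha>\<close>, and then both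
  joinands lie in \<open>\<gamma>\<close>.\<close>

lemma shifting_same_type:
  fixes B :: "'b set"
  assumes cm: "cong_modular_var ar E TYPE('b)" and v: "in_variety ar E B G"
    and con: "is_con ar B G \<alpha>" "is_con ar B G \<beta>" "is_con ar B G \<gamma>"
    and le: "\<alpha> \<inter> \<beta> \<subseteq> \<gamma>"
    and sq: "(a, b) \<in> \<alpha>" "(a, b) \<in> \<gamma>" "(c, d) \<in> \<alpha>" "(a, c) \<in> \<beta>" "(b, d) \<in> \<beta>"
  shows "(c, d) \<in> \<gamma>"
proof -
  have "con_join ar B G (\<gamma> \<inter> \<alpha>) \<beta> \<inter> \<alpha> = con_join ar B G (\<gamma> \<inter> \<alpha>) (\<beta> \<inter> \<alpha>)"
    using cm v con is_con_Int[OF con(3,1)] unfolding cong_modular_var_def by blast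
  moreover have "(c, d) \<in> con_join ar B G (\<gamma> \<inter> \<alpha>) \<beta>"
    unfolding con_join_def
  proof safe
    fix \<theta> assume t: "is_con ar B G \<theta>" and le: "\<gamma> \<inter> \<alpha> \<union> \<beta> \<subseteq> \<theta>"
    have "(c, a) \<in> \<theta>" "(a, b) \<in> \<theta>" "(b, d) \<in> \<theta>"
      using le sq is_con_sym[OF con(2)] by auto
    then show "(c, d) \<in> \<theta>" using is_con_trans[OF t] by blast
  qed
  ultimately have "(c, d) \<in> con_join ar B G (\<gamma> \<inter> \<alpha>) (\<beta> \<inter> \<alpha>)" using sq by blast
  then show ?thesis using con(3) le unfolding con_join_def by blast
qed

lemma shifting:
  fixes B :: "'d set" and h :: "'d \<Rightarrow> 'b"
  assumes cm: "cong_modular_var ar E TYPE('b)" and h: "inj h" and v: "in_variety ar E B G"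
    and con: "is_con ar B G \<alpha>" "is_con ar B G \<beta>" "is_con ar B G \<gamma>"
    and le: "\<alpha> \<inter> \<beta> \<subseteq> \<gamma>"
    and sq: "(a, b) \<in> \<alpha>" "(a, b) \<in> \<gamma>" "(c, d) \<in> \<alpha>" "(a, c) \<in> \<beta>" "(b, d) \<in> \<beta>"
  shows "(c, d) \<in> \<gamma>"
proof -
  have alg: "is_alg ar B G" using v by (simp add: in_variety_def)
  let ?p = "pull (h ` B) (inv h)"
  have le': "?p \<alpha> \<inter> ?p \<beta> \<subseteq> ?p \<gamma>" using le by (auto simp: pull_def)
  have "(h c, h d) \<in> ?p \<gamma>"
    by (rule shifting_same_type[where a = "h a" and b = "h b", OF cm in_variety_image[OF v h] con[THEN is_con_image[OF _ alg h]] le'])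
      (simp_all add: sq pull_image_iff[OF con(1) h] pull_image_iff[OF con(2) h] pull_image_iff[OF con(3) h])
  then show ?thesis using pull_image_iff[OF con(3) h] by blast
qed

section \<open>Compatible quaternary relations and the Kiss property\<close>

definition compat4 ::
  "('f \<Rightarrow> nat) \<Rightarrow> ('f \<Rightarrow> 'a list \<Rightarrow> 'a) \<Rightarrow> ('a \<Rightarrow> 'a \<Rightarrow> 'a \<Rightarrow> 'a \<Rightarrow> bool) \<Rightarrow> bool" where
  "compat4 ar G D \<longleftrightarrow> (\<forall>f a b c d. (\<forall>i<ar f. D (a i) (b i) (c i) (d i)) \<longrightarrow>
     D (G f (map a [0..<ar f])) (G f (map b [0..<ar f]))
       (G f (map c [0..<ar f])) (G f (map d [0..<ar f])))"

lemma compat4D: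
  assumes "compat4 ar G D" "\<And>i. i < ar f \<Longrightarrow> D (a i) (b i) (c i) (d i)"
  shows "D (G f (map a [0..<ar f])) (G f (map b [0..<ar f]))
       (G f (map c [0..<ar f])) (G f (map d [0..<ar f]))"
  using assms unfolding compat4_def by blast

lemma map_conv_upt: "length xs = n \<Longrightarrow> map g xs = map (\<lambda>i. g (xs ! i)) [0..<n]"
  by (auto intro: nth_equalityI)

lemma mk_sq_in_cubes:
  assumes "{a, b, c, d} \<subseteq> B"
  shows "mk_sq a b c d \<in> cubes {0, 1} \<rightarrow>\<^sub>E B"
  using assms by (auto simp: mk_sq_def)

lemma sq_in_cubes: "a \<in> {0, 1} \<Longrightarrow> b \<in> {0, 1} \<Longrightarrow> (\<lambda>_. undefined)(0 := a, 1 := b) \<in> cubes {0, 1}"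
  by (auto simp: cubes_def PiE_def extensional_def)

lemma sqv_mk_sq:
  "sqv (mk_sq a b c d) 0 0 = a" "sqv (mk_sq a b c d) 1 0 = b"
  "sqv (mk_sq a b c d) 0 1 = c" "sqv (mk_sq a b c d) 1 1 = d"
  using sq_in_cubes[of 0 0] sq_in_cubes[of 1 0] sq_in_cubes[of 0 1] sq_in_cubes[of 1 1]
  by (auto simp: mk_sq_def sqv_def)

lemma mk_sq_in_Rect:
  assumes "{a, b, c, d} \<subseteq> B" "(a, b) \<in> \<alpha>" "(c, d) \<in> \<alpha>" "(a, c) \<in> \<beta>" "(b, d) \<in> \<beta>"
  shows "mk_sq a b c d \<in> Rect B \<alpha> \<beta>"
  unfolding Rect_def using assms
  by (intro CollectI conjI mk_sq_in_cubes) (simp_all only: sqv_mk_sq)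

lemma kiss_termD:
  fixes B :: "'b set"
  assumes "kiss_term ar E q TYPE('b)" "in_variety ar E B G" "is_con ar B G \<alpha>" "is_con ar B G \<beta>"
    "mk_sq a b c d \<in> Rect B \<alpha> \<beta>" "mk_sq a b c d' \<in> Rect B \<alpha> \<beta>"
  shows "(evl G [a, b, c, d] q, evl G [a, b, c, d'] q) \<in> TC_comm ar B G \<alpha> \<beta>"
  using assms unfolding kiss_term_def by simp

lemma pw_op_closed:
  assumes "is_alg ar B G" "length xs = ar f" "set xs \<subseteq> I \<rightarrow>\<^sub>E B"
  shows "pw_op G I f xs \<in> I \<rightarrow>\<^sub>E B"
proof (rule PiE_I)
  fix g assume "g \<in> I"
  moreover have "set (map (\<lambda>x. x g) xs) \<subseteq> B" using assms(3) \<open>g \<in> I\<close> by (auto dest: PiE_mem)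
  ultimately show "pw_op G I f xs g \<in> B"
    using assms(1,2) by (simp add: pw_op_def is_alg_def)
qed (simp add: pw_op_def)

text \<open>The relation \<open>X\<close> is an upper bound for the matrices M(\<alpha>, \<beta>):
  by \<open>X0\<close> and \<open>X1\<close> it contains the generating squares, and it is closed
  under the operations. Hence \<open>C1\<close> and \<open>C2\<close> give both term conditions for
  \<delta>, and the commutator lies below \<delta>.\<close>

lemma kiss_term_centralizing:
  fixes B :: "'d set" and h :: "'d \<Rightarrow> 'b"
  assumes ki: "kiss_term ar E q TYPE('b)" and h: "inj h" and v: "in_variety ar E B G"
    and con: "is_con ar B G \<alpha>" "is_con ar B G \<beta>" "is_con ar B G \<delta>"
    and X0: "\<And>x y. (x, y) \<in> \<alpha> \<Longrightarrow> X x y x y" and X1: "\<And>x y. (x, y) \<in> \<beta> \<Longrightarrow> X x x y y"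
    and Xop: "compat4 ar G X"
    and C1: "\<And>x y z w. X x y z w \<Longrightarrow> (x, y) \<in> \<delta> \<Longrightarrow> (z, w) \<in> \<delta>"
    and C2: "\<And>x y z w. X x y z w \<Longrightarrow> (x, z) \<in> \<delta> \<Longrightarrow> (y, w) \<in> \<delta>"
    and sq: "(a, b) \<in> \<alpha>" "(c, d) \<in> \<alpha>" "(c, d') \<in> \<alpha>" "(a, c) \<in> \<beta>" "(b, d) \<in> \<beta>" "(b, d') \<in> \<beta>"
  shows "(evl G [a, b, c, d] q, evl G [a, b, c, d'] q) \<in> \<delta>"
proof -
  let ?G = "image_op h G" and ?B = "h ` B" and ?p = "pull (h ` B) (inv h)"
  have alg: "is_alg ar B G" using v by (simp add: in_variety_def)
  have alg': "is_alg ar ?B ?G" using alg h by (rule is_alg_image)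
  have v': "in_variety ar E ?B ?G" using v h by (rule in_variety_image)
  have con': "is_con ar ?B ?G (?p \<alpha>)" "is_con ar ?B ?G (?p \<beta>)" "is_con ar ?B ?G (?p \<delta>)"
    using con alg h by (simp_all add: is_con_image)
  have in_B: "{a, b, c, d, d'} \<subseteq> B" using sq is_con_dom[OF con(1)] by auto
  let ?X = "\<lambda>\<gamma>. X (inv h (sqv \<gamma> 0 0)) (inv h (sqv \<gamma> 1 0)) (inv h (sqv \<gamma> 0 1)) (inv h (sqv \<gamma> 1 1))"
  \<comment> \<open>The matrices consist of elements of the copy, so \<open>X\<close> is evaluated
    at their preimages under \<open>h\<close>.\<close>
  define R where "R = {\<gamma> \<in> cubes {0, 1} \<rightarrow>\<^sub>E ?B. ?X \<gamma>}"
  let ?I = "cubes {0, 1}"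
  have M: "Mgen ar ?B ?G {0, 1} (\<lambda>k. if k = 0 then ?p \<alpha> else ?p \<beta>) \<subseteq> R"
    unfolding Mgen_def gen_pow_def
  proof (rule Inter_lower, intro CollectI conjI)
    show "is_subuniv_pow ar ?B ?G ?I R"
      unfolding is_subuniv_pow_def
    proof (intro conjI allI impI)
      fix f xs assume *: "length xs = ar f \<and> set xs \<subseteq> R"
      have sqv_op: "inv h (sqv (pw_op ?G ?I f xs) i j) =
          G f (map (\<lambda>k. inv h (sqv (xs ! k) i j)) [0..<ar f])" if "i \<in> {0, 1}" "j \<in> {0, 1}" for i j
        using sq_in_cubes[OF that] * h
        by (simp add: sqv_def pw_op_def inv_image_op_hom map_conv_upt[of xs "ar f"] o_def)
      have "X (G f (map (\<lambda>k. inv h (sqv (xs ! k) 0 0)) [0..<ar f]))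
          (G f (map (\<lambda>k. inv h (sqv (xs ! k) 1 0)) [0..<ar f]))
          (G f (map (\<lambda>k. inv h (sqv (xs ! k) 0 1)) [0..<ar f]))
          (G f (map (\<lambda>k. inv h (sqv (xs ! k) 1 1)) [0..<ar f]))"
      proof (rule compat4D[OF Xop])
        fix i assume "i < ar f"
        then have "xs ! i \<in> R" using * nth_mem[of i xs] by auto
        then show "?X (xs ! i)" by (simp add: R_def)
      qed
      then have "?X (pw_op ?G ?I f xs)"
        by (simp only: sqv_op insert_iff simp_thms)
      moreover have "pw_op ?G ?I f xs \<in> ?I \<rightarrow>\<^sub>E ?B"
        using * by (intro pw_op_closed[OF alg']) (auto simp: R_def)
      ultimately show "pw_op ?G ?I f xs \<in> R" unfolding R_def by (intro CollectI conjI)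
    qed (simp add: R_def)
    have "cube {0, 1} k x y \<in> R"
      if "k \<in> {0, 1}" "(x, y) \<in> (if k = 0 then ?p \<alpha> else ?p \<beta>)" for k x y
    proof -
      have "x \<in> ?B" "y \<in> ?B" using that by (auto simp: pull_def split: if_splits)
      then have "cube {0, 1} k x y \<in> ?I \<rightarrow>\<^sub>E ?B" by (auto simp: cube_def)
      moreover have "?X (cube {0, 1} k x y)"
        using that X0 X1 sq_in_cubes[of 0 0] sq_in_cubes[of 1 0] sq_in_cubes[of 0 1] sq_in_cubes[of 1 1]
        by (auto simp: sqv_def cube_def pull_def)
      ultimately show ?thesis unfolding R_def by (intro CollectI conjI)
    qed
    then show "{cube {0, 1} k x y |k x y. k \<in> {0, 1} \<and> (x, y) \<in> (if k = 0 then ?p \<alpha> else ?p \<beta>)} \<subseteq> R"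
      by auto
  qed
  have p\<delta>: "(sqv \<gamma> i j, sqv \<gamma> i' j') \<in> ?p \<delta> \<longleftrightarrow> (inv h (sqv \<gamma> i j), inv h (sqv \<gamma> i' j')) \<in> \<delta>"
    if "\<gamma> \<in> R" "i \<in> {0, 1}" "j \<in> {0, 1}" "i' \<in> {0, 1}" "j' \<in> {0, 1}" for \<gamma> i j i' j'
    using that sq_in_cubes[of i j] sq_in_cubes[of i' j'] by (auto simp: R_def pull_def sqv_def PiE_iff)
  have "\<forall>\<gamma>\<in>Mgen ar ?B ?G {0, 1} (\<lambda>k. if k = 0 then ?p \<alpha> else ?p \<beta>).
        ((sqv \<gamma> 0 0, sqv \<gamma> 1 0) \<in> ?p \<delta> \<longrightarrow> (sqv \<gamma> 0 1, sqv \<gamma> 1 1) \<in> ?p \<delta>) \<and>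
        ((sqv \<gamma> 0 0, sqv \<gamma> 0 1) \<in> ?p \<delta> \<longrightarrow> (sqv \<gamma> 1 0, sqv \<gamma> 1 1) \<in> ?p \<delta>)"
  proof
    fix \<gamma> assume "\<gamma> \<in> Mgen ar ?B ?G {0, 1} (\<lambda>k. if k = 0 then ?p \<alpha> else ?p \<beta>)"
    then have R: "\<gamma> \<in> R" using M by blast
    then have X: "?X \<gamma>" by (simp add: R_def)
    show "((sqv \<gamma> 0 0, sqv \<gamma> 1 0) \<in> ?p \<delta> \<longrightarrow> (sqv \<gamma> 0 1, sqv \<gamma> 1 1) \<in> ?p \<delta>) \<and>
        ((sqv \<gamma> 0 0, sqv \<gamma> 0 1) \<in> ?p \<delta> \<longrightarrow> (sqv \<gamma> 1 0, sqv \<gamma> 1 1) \<in> ?p \<delta>)"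
      using C1[OF X] C2[OF X] R by (simp add: p\<delta>)
  qed
  then have TC: "TC_comm ar ?B ?G (?p \<alpha>) (?p \<beta>) \<subseteq> ?p \<delta>"
    unfolding TC_comm_def using con'(3) by (intro Inter_lower) blast
  have rect: "mk_sq (h a) (h b) (h c) (h e) \<in> Rect ?B (?p \<alpha>) (?p \<beta>)" if "e = d \<or> e = d'" for e
    using that sq in_B
    by (intro mk_sq_in_Rect) (auto simp: pull_image_iff[OF con(1) h] pull_image_iff[OF con(2) h])
  have "(evl ?G [h a, h b, h c, h d] q, evl ?G [h a, h b, h c, h d'] q) \<in> TC_comm ar ?B ?G (?p \<alpha>) (?p \<beta>)"
    using con'(1,2) rect by (intro kiss_termD[OF ki v']) auto
  then have "(h (evl G [a, b, c, d] q), h (evl G [a, b, c, d'] q)) \<in> ?p \<delta>"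
    using TC ki by (subst (1 2) evl_hom[of h G ?G, OF image_op_hom[OF h]]) (auto simp: kiss_term_def)
  then show ?thesis using pull_image_iff[OF con(3) h] by blast
qed

text \<open>Chains for different arguments may have different lengths, so one argument is moved at a
  time while reflexivity keeps the others fixed.\<close>

lemma trancl_compat:
  assumes R: "R \<subseteq> Q \<times> Q" "\<And>x. x \<in> Q \<Longrightarrow> (x, x) \<in> R"
    and op: "\<And>xs ys. length xs = ar f \<Longrightarrow> list_all2 (\<lambda>x y. (x, y) \<in> R) xs ys \<Longrightarrow> (G f xs, G f ys) \<in> R"
    and "length xs = ar f" and "list_all2 (\<lambda>x y. (x, y) \<in> R\<^sup>+) xs ys"
  shows "(G f xs, G f ys) \<in> R\<^sup>+"
proof -
  have RQ: "R\<^sup>+ \<subseteq> Q \<times> Q" using R(1) by (rule trancl_subset_Sigma)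
  have refl: "list_all2 (\<lambda>x y. (x, y) \<in> R) zs zs" if "set zs \<subseteq> Q" for zs
    using that R(2) by (auto simp: list_all2_conv_all_nth subset_iff)
  have one: "(G f (ws @ x # zs), G f (ws @ y # zs)) \<in> R\<^sup>+"
    if "(x, y) \<in> R\<^sup>+" "set ws \<subseteq> Q" "set zs \<subseteq> Q" "length (ws @ x # zs) = ar f" for x y ws zs
    using that(1)
  proof induction
    case (base y)
    then have "(G f (ws @ x # zs), G f (ws @ y # zs)) \<in> R"
      using that refl by (intro op) (auto intro!: list_all2_appendI)
    then show ?case by blast
  next
    case (step y z)
    then have "(G f (ws @ y # zs), G f (ws @ z # zs)) \<in> R"
      using that refl by (intro op) (auto intro!: list_all2_appendI)
    with step.IH show ?case by (rule trancl_into_trancl)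
  qed
  \<comment> \<open>The list \<open>ws\<close> holds the arguments that have already been
    moved.\<close>
  have "(G f (ws @ xs), G f (ws @ ys)) \<in> R\<^sup>+"
    if "list_all2 (\<lambda>x y. (x, y) \<in> R\<^sup>+) xs ys" "set ws \<subseteq> Q" "length (ws @ xs) = ar f" for ws
    using that
  proof (induction arbitrary: ws rule: list_all2_induct)
    case Nil
    then have "(G f ws, G f ws) \<in> R" using refl by (intro op) auto
    then show ?case by auto
  next
    case (Cons x xs y ys)
    have "set xs \<subseteq> Q" "y \<in> Q" using Cons.hyps RQ list_all2_in_Times[of "R\<^sup>+" xs ys Q Q] by auto
    then have "(G f (ws @ x # xs), G f (ws @ y # xs)) \<in> R\<^sup>+"
      using Cons by (intro one) auto
    moreover have "(G f ((ws @ [y]) @ xs), G f ((ws @ [y]) @ ys)) \<in> R\<^sup>+"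
      using Cons.prems \<open>y \<in> Q\<close> by (intro Cons.IH) auto
    ultimately show ?case by simp
  qed
  from this[of "[]"] show ?thesis using assms by simp
qed

subsection \<open>Two-dimensional congruences\<close>

text \<open>The arguments of \<open>D\<close> are the corners 00, 10, 01, 11; the index 0 or 1 in
  the names of the axioms is the direction. The injection \<open>pr\<close> encodes pairs at the
  type where modularity and the Kiss property are available, and iterating it encodes pairs of
  pairs.\<close>

locale square_congruence =
  fixes ar :: "'f \<Rightarrow> nat" and E :: "('f trm \<times> 'f trm) set" and q :: "'f trm"
    and C :: "'c set" and H :: "'f \<Rightarrow> 'c list \<Rightarrow> 'c" and D :: "'c \<Rightarrow> 'c \<Rightarrow> 'c \<Rightarrow> 'c \<Rightarrow> bool"
    and pr :: "'c \<times> 'c \<Rightarrow> 'c"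
  assumes cm: "cong_modular_var ar E TYPE('c)"
    and ki: "kiss_term ar E q TYPE('c)"
    and pr: "inj pr"
    and V: "in_variety ar E C H"
    and D_dom: "D a b c d \<Longrightarrow> a \<in> C \<and> b \<in> C \<and> c \<in> C \<and> d \<in> C"
    and D_refl: "x \<in> C \<Longrightarrow> D x x x x"
    and D_faces: "D a b c d \<Longrightarrow> D a b a b \<and> D c d c d \<and> D a a c c \<and> D b b d d"
    and D_sym0: "D a b c d \<Longrightarrow> D b a d c"
    and D_sym1: "D a b c d \<Longrightarrow> D c d a b"
    and D_trans0: "D a b c d \<Longrightarrow> D b e d g \<Longrightarrow> D a e c g"
    and D_trans1: "D a b c d \<Longrightarrow> D c d e g \<Longrightarrow> D a b e g"
    and D_op: "compat4 ar H D"
begin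

section \<open>Edge congruences, and the algebra of edges in direction 0\<close>

definition phi :: "'c rel" where "phi = {(x, y). D x y x y}"
definition psi :: "'c rel" where "psi = {(x, y). D x x y y}"
definition del :: "('c \<times> 'c) rel" where "del = {((x, y), (x', y')). D x y x' y'}"
definition psi0 :: "('c \<times> 'c) rel" where "psi0 = pull phi fst psi"
definition psi1 :: "('c \<times> 'c) rel" where "psi1 = psi0 \<inter> pull phi snd psi"

lemma is_con_phi: "is_con ar C H phi"
proof (rule is_conI)
  show "phi \<subseteq> C \<times> C" using D_dom by (auto simp: phi_def)
  show "sym phi" using D_sym0 by (auto simp: phi_def sym_def)
  show "trans phi" using D_trans0 unfolding phi_def trans_def by blast
  show "(x, x) \<in> phi" if "x \<in> C" for x using D_refl that by (simp add: phi_def)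
  fix f xs ys assume *: "length xs = ar f" "length ys = ar f" "list_all2 (\<lambda>x y. (x, y) \<in> phi) xs ys"
  then have "D (H f (map ((!) xs) [0..<ar f])) (H f (map ((!) ys) [0..<ar f]))
      (H f (map ((!) xs) [0..<ar f])) (H f (map ((!) ys) [0..<ar f]))"
    by (intro compat4D[OF D_op]) (auto simp: list_all2_conv_all_nth phi_def)
  then show "(H f xs, H f ys) \<in> phi"
    using * map_nth[of xs] map_nth[of ys] by (simp add: phi_def)
qed

lemma is_con_psi: "is_con ar C H psi"
proof (rule is_conI)
  show "psi \<subseteq> C \<times> C" using D_dom by (auto simp: psi_def)
  show "sym psi" using D_sym1 by (auto simp: psi_def sym_def)
  show "trans psi" using D_trans1 unfolding psi_def trans_def by blast
  show "(x, x) \<in> psi" if "x \<in> C" for x using D_refl that by (simp add: psi_def)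
  fix f xs ys assume *: "length xs = ar f" "length ys = ar f" "list_all2 (\<lambda>x y. (x, y) \<in> psi) xs ys"
  then have "D (H f (map ((!) xs) [0..<ar f])) (H f (map ((!) xs) [0..<ar f]))
      (H f (map ((!) ys) [0..<ar f])) (H f (map ((!) ys) [0..<ar f]))"
    by (intro compat4D[OF D_op]) (auto simp: list_all2_conv_all_nth psi_def)
  then show "(H f xs, H f ys) \<in> psi"
    using * map_nth[of xs] map_nth[of ys] by (simp add: psi_def)
qed

lemma V_phi: "in_variety ar E phi (pair_op H)"
  by (rule in_variety_con[OF V is_con_phi])

lemma alg_phi: "is_alg ar phi (pair_op H)"
  using V_phi by (simp add: in_variety_def)

lemma fst_phi: "fst ` phi \<subseteq> C" and snd_phi: "snd ` phi \<subseteq> C"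
  using is_con_dom[OF is_con_phi] by auto

lemma is_con_psi0: "is_con ar phi (pair_op H) psi0"
  unfolding psi0_def by (rule is_con_pull[OF is_con_psi alg_phi fst_phi fst_pair_op])

lemma is_con_psi1: "is_con ar phi (pair_op H) psi1"
  unfolding psi1_def
  by (rule is_con_Int[OF is_con_psi0 is_con_pull[OF is_con_psi alg_phi snd_phi snd_pair_op]])

lemma psi0_iff: "(u, v) \<in> psi0 \<longleftrightarrow> u \<in> phi \<and> v \<in> phi \<and> (fst u, fst v) \<in> psi"
  by (simp add: psi0_def pull_def)

lemma psi1_iff: "(u, v) \<in> psi1 \<longleftrightarrow> u \<in> phi \<and> v \<in> phi \<and> (fst u, fst v) \<in> psi \<and> (snd u, snd v) \<in> psi"
  by (auto simp: psi1_def psi0_def pull_def)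

text \<open>A square is read as a pair of parallel edges in direction 0. Symmetry and transitivity
  come from direction 1, and reflexivity is membership in \<open>phi\<close>.\<close>

lemma is_con_del: "is_con ar phi (pair_op H) del"
proof (rule is_conI)
  show "del \<subseteq> phi \<times> phi" using D_faces by (auto simp: del_def phi_def)
  show "sym del" using D_sym1 by (auto simp: del_def sym_def)
  show "trans del" using D_trans1 unfolding del_def trans_def by blast
  show "(x, x) \<in> del" if "x \<in> phi" for x using that by (auto simp: del_def phi_def)
  fix f xs ys assume *: "length xs = ar f" "length ys = ar f" "list_all2 (\<lambda>x y. (x, y) \<in> del) xs ys"
  then have "D (H f (map (\<lambda>i. fst (xs ! i)) [0..<ar f])) (H f (map (\<lambda>i. snd (xs ! i)) [0..<ar f]))
      (H f (map (\<lambda>i. fst (ys ! i)) [0..<ar f])) (H f (map (\<lambda>i. snd (ys ! i)) [0..<ar f]))"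
    by (intro compat4D[OF D_op]) (auto simp: list_all2_conv_all_nth del_def split_beta)
  then show "(pair_op H f xs, pair_op H f ys) \<in> del"
    using * by (simp add: del_def pair_op_def map_conv_upt[of xs "ar f"] map_conv_upt[of ys "ar f"])
qed

text \<open>The relation \<open>X\<close> contains the matrices generated by \<^term>\<open>psi0\<close> and \<^term>\<open>psi1\<close>: moving
  along \<open>(x, y) \<mapsto> (x, x) \<mapsto> (x', x') \<mapsto> (x', y')\<close> for \<open>((x, y), (x', y')) \<in> psi0\<close>, the
  \<open>z\<^sub>i\<close> are the second components of the intermediate entries.\<close>

definition X :: "'c \<times> 'c \<Rightarrow> 'c \<times> 'c \<Rightarrow> 'c \<times> 'c \<Rightarrow> 'c \<times> 'c \<Rightarrow> bool" where
  "X e g f h \<longleftrightarrow> (\<exists>z0 z1 z2 z3. D (fst e) z0 (fst g) z2 \<and> D (fst f) z1 (fst h) z3 \<and>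
     D (snd e) z0 (snd f) z1 \<and> D z2 (snd g) z3 (snd h) \<and>
     (e, f) \<in> psi1 \<and> (g, h) \<in> psi1)"

lemma X_psi0:
  assumes "(x, y) \<in> psi0" shows "X x y x y"
proof -
  have *: "D (fst x) (fst x) (fst y) (fst y)" "D (fst x) (snd x) (fst x) (snd x)"
      "D (fst y) (snd y) (fst y) (snd y)" "(x, x) \<in> psi1" "(y, y) \<in> psi1"
    using assms is_con_refl[OF is_con_psi1] by (auto simp: psi0_iff psi_def phi_def)
  \<comment> \<open>The witnesses are \<open>z0 = z1 = fst x\<close> and
    \<open>z2 = z3 = fst y\<close>.\<close>
  then show ?thesis unfolding X_def using D_sym0[OF *(2)] by blast
qed

lemma X_psi1:
  assumes "(x, y) \<in> psi1" shows "X x x y y"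
proof -
  have "D (snd x) (snd x) (snd y) (snd y)" "D (fst x) (snd x) (fst x) (snd x)"
      "D (fst y) (snd y) (fst y) (snd y)"
    using assms by (auto simp: psi1_iff psi_def phi_def)
  \<comment> \<open>The witnesses are \<open>z0 = z2 = snd x\<close> and
    \<open>z1 = z3 = snd y\<close>.\<close>
  then show ?thesis unfolding X_def using assms by blast
qed

text \<open>The reversal interchanges \<open>z0\<close> with \<open>z2\<close> and \<open>z1\<close>
  with \<open>z3\<close>.\<close>

lemma X_sym: "X e g f h \<Longrightarrow> X g e h f"
  unfolding X_def using D_sym0 D_sym1 by meson

lemma X_in_psi0:
  assumes "X e g f h" shows "(e, g) \<in> psi0"
proof -
  obtain z0 z2 where "D (fst e) z0 (fst g) z2" "(e, f) \<in> psi1" "(g, h) \<in> psi1"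
    using assms unfolding X_def by blast
  then show ?thesis using D_faces by (auto simp: psi0_iff psi1_iff psi_def)
qed

text \<open>The term condition obtained by a diagram chase: extend the square on \<open>e\<close>,
  \<open>f\<close> in direction 0 up to \<open>z0\<close>, \<open>z1\<close>, replace its edges in
  direction 1 to reach \<open>z2\<close>, \<open>z3\<close>, and extend in direction 0 again to
  reach \<open>snd g\<close>, \<open>snd h\<close>.\<close>

lemma X_central:
  assumes "X e g f h" "(e, f) \<in> del" shows "(g, h) \<in> del"
proof -
  obtain z0 z1 z2 z3 where z: "D (fst e) z0 (fst g) z2" "D (fst f) z1 (fst h) z3"
     "D (snd e) z0 (snd f) z1" "D z2 (snd g) z3 (snd h)"
    using assms unfolding X_def by blast
  have "D (fst e) (snd e) (fst f) (snd f)" using assms(2) by (auto simp: del_def)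
  then have "D (fst e) z0 (fst f) z1" using z(3) by (rule D_trans0)
  then have "D (fst g) z2 (fst h) z3" using z(1,2) D_trans1 D_sym1 by meson
  then have "D (fst g) (snd g) (fst h) (snd h)" using z(4) by (rule D_trans0)
  then show ?thesis by (simp add: del_def split_beta)
qed

lemma X_op: "compat4 ar (pair_op H) X"
  unfolding compat4_def
proof (intro allI impI)
  fix p and e g f h :: "nat \<Rightarrow> 'c \<times> 'c"
  assume *: "\<forall>i<ar p. X (e i) (g i) (f i) (h i)"
  then have "\<forall>i. \<exists>z0 z1 z2 z3. i < ar p \<longrightarrow> D (fst (e i)) z0 (fst (g i)) z2 \<and>
      D (fst (f i)) z1 (fst (h i)) z3 \<and> D (snd (e i)) z0 (snd (f i)) z1 \<and> D z2 (snd (g i)) z3 (snd (h i))"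
    unfolding X_def by blast
  then obtain z0 z1 z2 z3 where z: "\<And>i. i < ar p \<Longrightarrow> D (fst (e i)) (z0 i) (fst (g i)) (z2 i)"
      "\<And>i. i < ar p \<Longrightarrow> D (fst (f i)) (z1 i) (fst (h i)) (z3 i)"
      "\<And>i. i < ar p \<Longrightarrow> D (snd (e i)) (z0 i) (snd (f i)) (z1 i)"
      "\<And>i. i < ar p \<Longrightarrow> D (z2 i) (snd (g i)) (z3 i) (snd (h i))"
    by metis
  have psi: "(pair_op H p (map a [0..<ar p]), pair_op H p (map b [0..<ar p])) \<in> psi1"
    if "\<forall>i<ar p. (a i, b i) \<in> psi1" for a b
    using that by (intro is_con_compat[OF is_con_psi1]) (auto simp: list_all2_conv_all_nth)
  show "X (pair_op H p (map e [0..<ar p])) (pair_op H p (map g [0..<ar p]))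
      (pair_op H p (map f [0..<ar p])) (pair_op H p (map h [0..<ar p]))"
    unfolding X_def
    apply (rule exI[of _ "H p (map z0 [0..<ar p])"], rule exI[of _ "H p (map z1 [0..<ar p])"])
    apply (rule exI[of _ "H p (map z2 [0..<ar p])"], rule exI[of _ "H p (map z3 [0..<ar p])"])
    unfolding fst_pair_op snd_pair_op map_map o_def
    using * by (intro conjI compat4D[OF D_op] z psi) (auto simp: X_def)
qed

text \<open>\<open>X\<close> is regrouped as a relation between the \<open>psi1\<close>-edges
  \<open>(e, f)\<close> and \<open>(g, h)\<close>. There it is reflexive, symmetric and compatible,
  so its transitive closure is a congruence on the algebra \<open>psi1\<close>, to which the
  shifting lemma applies.\<close>

definition L :: "(('c \<times> 'c) \<times> ('c \<times> 'c)) rel" where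
  "L = {((e, f), (g, h)). X e g f h}\<^sup>+"

lemma V_psi1: "in_variety ar E psi1 (pair_op (pair_op H))"
  by (rule in_variety_con[OF V_phi is_con_psi1])

lemma alg_psi1: "is_alg ar psi1 (pair_op (pair_op H))"
  using V_psi1 by (simp add: in_variety_def)

lemma is_con_L: "is_con ar psi1 (pair_op (pair_op H)) L"
proof -
  let ?R = "{((e, f), (g, h)). X e g f h}"
  have sub: "?R \<subseteq> psi1 \<times> psi1" by (auto simp: X_def)
  have refl: "(x, x) \<in> ?R" if "x \<in> psi1" for x using that X_psi1 by (cases x) auto
  show ?thesis unfolding L_def
  proof (rule is_conI)
    show "?R\<^sup>+ \<subseteq> psi1 \<times> psi1" using sub by (rule trancl_subset_Sigma)
    show "sym (?R\<^sup>+)" by (rule sym_trancl) (auto simp: sym_def intro: X_sym)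
    show "(x, x) \<in> ?R\<^sup>+" if "x \<in> psi1" for x using refl[OF that] by blast
    fix f xs ys assume *: "length xs = ar f" "list_all2 (\<lambda>x y. (x, y) \<in> ?R\<^sup>+) xs ys"
    show "(pair_op (pair_op H) f xs, pair_op (pair_op H) f ys) \<in> ?R\<^sup>+"
    proof (rule trancl_compat[where ar = ar, OF sub refl _ *])
      fix xs ys assume *: "length xs = ar f" "list_all2 (\<lambda>x y. (x, y) \<in> ?R) xs ys"
      have l: "length ys = ar f" using * by (auto dest: list_all2_lengthD)
      have "X (pair_op H f (map (\<lambda>i. fst (xs ! i)) [0..<ar f])) (pair_op H f (map (\<lambda>i. fst (ys ! i)) [0..<ar f]))
        (pair_op H f (map (\<lambda>i. snd (xs ! i)) [0..<ar f])) (pair_op H f (map (\<lambda>i. snd (ys ! i)) [0..<ar f]))"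
        using * by (intro compat4D[OF X_op]) (auto simp: list_all2_conv_all_nth split_beta)
      then show "(pair_op (pair_op H) f xs, pair_op (pair_op H) f ys) \<in> ?R"
        using * l by (simp add: pair_op_def[of "pair_op H"]
          map_conv_upt[of xs "ar f"] map_conv_upt[of ys "ar f"])
    qed
  qed simp
qed

text \<open>\<open>X_central\<close> is applied to each link of the chain; thus the
  \<open>del\<close>-pairs in \<open>psi1\<close> form a union of \<open>L\<close>-classes.\<close>

lemma L_central:
  assumes "((e, f), (g, h)) \<in> L" "(e, f) \<in> del" shows "(g, h) \<in> del"
  using assms(1) unfolding L_def
proof (induction "(g, h)" arbitrary: g h rule: trancl_induct)
  case base
  then show ?case using X_central assms(2) by auto
next
  case (step y)
  then show ?case using X_central by (cases y) auto
qed

lemma shifting_psi1: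
  assumes "is_con ar psi1 (pair_op (pair_op H)) \<alpha>" "is_con ar psi1 (pair_op (pair_op H)) \<beta>"
    "is_con ar psi1 (pair_op (pair_op H)) \<gamma>" "\<alpha> \<inter> \<beta> \<subseteq> \<gamma>"
    "(a, b) \<in> \<alpha>" "(a, b) \<in> \<gamma>" "(c, d) \<in> \<alpha>" "(a, c) \<in> \<beta>" "(b, d) \<in> \<beta>"
  shows "(c, d) \<in> \<gamma>"
proof (rule shifting[OF cm _ V_psi1 assms])
  show "inj (pr \<circ> map_prod pr pr)" using pr by (intro inj_compose prod.inj_map)
qed

text \<open>The first shift moves a pair of elements with equal first components to the diagonal,
  where saturation of \<^term>\<open>del\<close> under \<^term>\<open>L\<close> applies; the second
  interchanges the two directions of the square.\<close>

lemma X_central':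
  assumes X: "X e g f h" and eg: "(e, g) \<in> del" shows "(f, h) \<in> del"
proof -
  let ?O = "pair_op (pair_op H)"
  \<comment> \<open>\<open>\<eta>0\<close> and \<open>\<eta>1\<close> are the kernels of the two
    projections of \<open>psi1\<close>, and \<open>\<gamma>\<close> is the product of
    \<open>del\<close> with itself on \<open>psi1\<close>.\<close>
  define \<eta>0 where "\<eta>0 = pull psi1 fst (Id_on phi)"
  define \<eta>1 where "\<eta>1 = pull psi1 snd (Id_on phi)"
  define \<gamma> where "\<gamma> = pull psi1 fst del \<inter> pull psi1 snd del"
  note defs = \<eta>0_def \<eta>1_def \<gamma>_def pull_def
  have im: "fst ` psi1 \<subseteq> phi" "snd ` psi1 \<subseteq> phi" by (auto simp: psi1_iff)
  have con: "is_con ar psi1 ?O \<eta>0" "is_con ar psi1 ?O \<eta>1" "is_con ar psi1 ?O \<gamma>"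
    unfolding \<eta>0_def \<eta>1_def \<gamma>_def
    using is_con_pull[OF _ alg_psi1 im(1) fst_pair_op] is_con_pull[OF _ alg_psi1 im(2) snd_pair_op]
      is_con_Id_on[OF alg_phi] is_con_del by (auto intro: is_con_Int)
  have psi1: "(e, f) \<in> psi1" "(g, h) \<in> psi1" using X by (auto simp: X_def)
  have le: "L \<inter> \<eta>0 \<subseteq> \<gamma>"
  proof
    fix uv assume uv: "uv \<in> L \<inter> \<eta>0"
    then obtain p r s where uv_eq: "uv = ((p, r), (p, s))" and p_r: "(p, r) \<in> psi1" and ps: "(p, s) \<in> psi1"
      and phi: "p \<in> phi" "r \<in> phi" "s \<in> phi"
      unfolding defs by (auto simp: psi1_iff)
    have rs: "(r, s) \<in> psi1" "(r, r) \<in> psi1"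
      using p_r ps is_con_sym[OF is_con_psi1] is_con_trans[OF is_con_psi1] by blast+
    have "((r, r), (r, s)) \<in> L"
    proof (rule shifting_psi1[OF con(1,2) is_con_L])
      show "\<eta>0 \<inter> \<eta>1 \<subseteq> L" using is_con_refl[OF is_con_L] unfolding defs by auto
      show "((p, r), (p, s)) \<in> L" using uv uv_eq by blast
    qed (use p_r ps rs phi in \<open>auto simp: defs\<close>)
    then have "(r, s) \<in> del" using L_central is_con_refl[OF is_con_del] phi by blast
    then show "uv \<in> \<gamma>"
      using uv_eq p_r ps phi is_con_refl[OF is_con_del] by (auto simp: defs)
  qed
  have "((e, f), (g, h)) \<in> \<gamma>"
  proof (rule shifting_psi1[OF is_con_L con(1,3) le])
    show "((e, e), (g, g)) \<in> L" unfolding L_def using X_psi0[OF X_in_psi0[OF X]] by auto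
    show "((e, f), (g, h)) \<in> L" unfolding L_def using X by auto
  qed (use psi1 eg is_con_refl[OF is_con_psi1] in \<open>auto simp: defs psi1_iff\<close>)
  then show ?thesis by (simp add: defs)
qed

theorem square_completion:
  assumes "D a b a b" "D c d c d" "D a a c c" "D b b d d"
  shows "D a b c (evl H [a, b, c, d] q)"
proof -
  let ?K = "pair_op H"
  have q: "wf_trm ar q" "vars q \<subseteq> {0..<Suc (Suc (Suc (Suc 0)))}"
    using ki by (auto simp: kiss_term_def eval_nat_numeral)
  have in_C: "a \<in> C" "b \<in> C" "c \<in> C" "d \<in> C" using assms D_dom by blast+
  have phi: "(a, a) \<in> phi" "(a, b) \<in> phi" "(c, c) \<in> phi" "(c, d) \<in> phi"
    using assms D_faces D_refl in_C by (auto simp: phi_def)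
  have id: "evl H [x, x, y, y] q = y" "evl H [x, y, x, y] q = y" if "x \<in> C" "y \<in> C" for x y
    using ki V that unfolding kiss_term_def by blast+
  have hom: "evl ?K [u, v, w, x] q = (evl H (map fst [u, v, w, x]) q, evl H (map snd [u, v, w, x]) q)"
    for u v w x
    using q evl_hom[of fst ?K H q "[u, v, w, x]", OF fst_pair_op]
      evl_hom[of snd ?K H q "[u, v, w, x]", OF snd_pair_op]
    by (auto simp: prod_eq_iff)
  \<comment> \<open>Compatibility suffices here, because \<open>D a a c c\<close> makes
    \<open>(a, a)\<close> and \<open>(c, c)\<close> congruent modulo \<open>del\<close>.\<close>
  have "(evl ?K [(a, a), (a, b), (c, c), (c, d)] q, evl ?K [(a, a), (a, b), (a, a), (c, d)] q) \<in> del"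
    using q assms phi by (intro evl_con[OF is_con_del]) (auto simp: del_def phi_def intro: D_sym1)
  moreover have "(evl ?K [(a, a), (a, b), (a, a), (c, d)] q, evl ?K [(a, a), (a, b), (a, a), (a, b)] q) \<in> del"
    \<comment> \<open>Only first components matter for \<open>psi0\<close>, so it relates
      \<open>(a, a)\<close> to \<open>(c, d)\<close> although no \<psi>-edge from \<open>a\<close>
      to \<open>d\<close> is assumed.\<close>
    by (rule kiss_term_centralizing[where X = X, OF ki pr V_phi is_con_psi0 is_con_psi1 is_con_del
          X_psi0 X_psi1 X_op X_central' X_central])
      (use assms phi in_C D_refl in \<open>auto simp: psi0_iff psi1_iff psi_def\<close>)
  ultimately have "(evl ?K [(a, a), (a, b), (c, c), (c, d)] q, evl ?K [(a, a), (a, b), (a, a), (a, b)] q) \<in> del"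
    using is_con_trans[OF is_con_del] by blast
  then have "((c, evl H [a, b, c, d] q), (a, b)) \<in> del"
    unfolding hom by (simp add: id in_C)
  then show ?thesis using D_sym1 by (simp add: del_def)
qed

end

subsection \<open>Cubes\<close>

lemma cubes_upd: "f \<in> cubes S \<Longrightarrow> i \<in> S \<Longrightarrow> j \<in> {0, 1} \<Longrightarrow> f(i := j) \<in> cubes S"
  unfolding cubes_def by (auto simp: PiE_iff extensional_def)

lemma cubes_val: "f \<in> cubes S \<Longrightarrow> i \<in> S \<Longrightarrow> f i = 0 \<or> f i = 1"
  unfolding cubes_def by (auto simp: PiE_iff)

lemma cubes_del: "f \<in> cubes S \<Longrightarrow> f(i := undefined) \<in> cubes (S - {i})"
  unfolding cubes_def by (auto simp: PiE_iff extensional_def)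

lemma cubes_ins: "g \<in> cubes (S - {i}) \<Longrightarrow> i \<in> S \<Longrightarrow> j \<in> {0, 1} \<Longrightarrow> g(i := j) \<in> cubes S"
  unfolding cubes_def by (auto simp: PiE_iff extensional_def)

lemma cubes_flip: "f \<in> cubes S \<Longrightarrow> i \<in> S \<Longrightarrow> f(i := 1 - f i) \<in> cubes S"
  using cubes_val[of f S i] by (auto intro!: cubes_upd)

text \<open>Faces live over a smaller index set; expressing degeneration by a change of the argument
  keeps every cube over \<open>S\<close>.\<close>

lemma refl_c_eq: "refl_c S i j \<gamma> = (\<lambda>f\<in>cubes S. \<gamma> (f(i := j)))"
  by (rule ext) (auto simp: refl_c_def glue_def face_def cubes_del restrict_def)

lemma sym_c_eq: "i \<in> S \<Longrightarrow> sym_c S i \<gamma> = (\<lambda>f\<in>cubes S. \<gamma> (f(i := 1 - f i)))"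
  by (rule ext) (auto simp: sym_c_def glue_def face_def cubes_del restrict_def dest: cubes_val)

lemma face_eq_iff:
  assumes "i \<in> S"
  shows "face S i j \<gamma> = face S i k \<gamma>' \<longleftrightarrow> (\<forall>f\<in>cubes S. \<gamma> (f(i := j)) = \<gamma>' (f(i := k)))"
proof
  assume *: "face S i j \<gamma> = face S i k \<gamma>'"
  show "\<forall>f\<in>cubes S. \<gamma> (f(i := j)) = \<gamma>' (f(i := k))"
  proof
    fix f assume "f \<in> cubes S"
    then show "\<gamma> (f(i := j)) = \<gamma>' (f(i := k))"
      using fun_cong[OF *, of "f(i := undefined)"] by (simp add: face_def cubes_del)
  qed
next
  assume *: "\<forall>f\<in>cubes S. \<gamma> (f(i := j)) = \<gamma>' (f(i := k))"
  show "face S i j \<gamma> = face S i k \<gamma>'"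
    unfolding face_def
  proof (rule restrict_ext)
    fix g assume "g \<in> cubes (S - {i})"
    then show "\<gamma> (g(i := j)) = \<gamma>' (g(i := k))"
      using *[rule_format, of "g(i := 0)"] assms by (simp add: cubes_ins)
  qed
qed

text \<open>A cube is determined by its two faces in direction \<open>i\<close>, so transitivity
  amounts to closure under gluing two cubes along a common face.\<close>

lemma trans_face_rel_iff:
  assumes R: "R \<subseteq> cubes S \<rightarrow>\<^sub>E B" and i: "i \<in> S"
  shows "trans (face_rel S i R) \<longleftrightarrow> (\<forall>\<gamma>\<in>R. \<forall>\<gamma>'\<in>R.
    (\<forall>f\<in>cubes S. \<gamma> (f(i := 1)) = \<gamma>' (f(i := 0))) \<longrightarrow> (\<lambda>f\<in>cubes S. if f i = 0 then \<gamma> f else \<gamma>' f) \<in> R)"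
    (is "?L \<longleftrightarrow> ?R")
proof
  assume t: ?L
  show ?R
  proof (intro ballI impI)
    fix \<gamma> \<gamma>' assume g: "\<gamma> \<in> R" "\<gamma>' \<in> R" and eq: "\<forall>f\<in>cubes S. \<gamma> (f(i := 1)) = \<gamma>' (f(i := 0))"
    have "face S i 1 \<gamma> = face S i 0 \<gamma>'" using eq i by (simp add: face_eq_iff)
    then have "(face S i 0 \<gamma>, face S i 1 \<gamma>) \<in> face_rel S i R"
      "(face S i 1 \<gamma>, face S i 1 \<gamma>') \<in> face_rel S i R"
      using g unfolding face_rel_def by auto
    then have "(face S i 0 \<gamma>, face S i 1 \<gamma>') \<in> face_rel S i R" using t by (meson transE)
    then obtain \<delta> where d: "\<delta> \<in> R" "face S i 0 \<delta> = face S i 0 \<gamma>" "face S i 1 \<delta> = face S i 1 \<gamma>'"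
      unfolding face_rel_def by auto
    \<comment> \<open>The cube \<open>\<delta>\<close> is known only through its faces; with
      extensionality these determine it.\<close>
    have "\<delta> = (\<lambda>f\<in>cubes S. if f i = 0 then \<gamma> f else \<gamma>' f)"
    proof
      fix f
      show "\<delta> f = (\<lambda>f\<in>cubes S. if f i = 0 then \<gamma> f else \<gamma>' f) f"
      proof (cases "f \<in> cubes S")
        case True
        then have "\<delta> (f(i := 0)) = \<gamma> (f(i := 0))" "\<delta> (f(i := 1)) = \<gamma>' (f(i := 1))"
          using d i by (simp_all only: face_eq_iff)
        moreover have "f(i := f i) = f" by simp
        ultimately show ?thesis using True cubes_val[OF True i] by (auto simp: fun_upd_idem)
      next
        case False
        then show ?thesis using d(1) R by (auto simp: PiE_iff extensional_def)
      qed
    qed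
    then show "(\<lambda>f\<in>cubes S. if f i = 0 then \<gamma> f else \<gamma>' f) \<in> R" using d by simp
  qed
next
  assume *: ?R
  show ?L
  proof (rule transI)
    fix x y z assume "(x, y) \<in> face_rel S i R" "(y, z) \<in> face_rel S i R"
    then obtain \<gamma> \<gamma>' where g: "\<gamma> \<in> R" "\<gamma>' \<in> R" "x = face S i 0 \<gamma>" "y = face S i 1 \<gamma>"
      "y = face S i 0 \<gamma>'" "z = face S i 1 \<gamma>'"
      unfolding face_rel_def by auto
    let ?d = "\<lambda>f\<in>cubes S. if f i = 0 then \<gamma> f else \<gamma>' f"
    have "face S i 1 \<gamma> = face S i 0 \<gamma>'" using g by simp
    then have "?d \<in> R" using * g(1,2) i by (simp only: face_eq_iff)
    moreover have "face S i 0 ?d = x" "face S i 1 ?d = z"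
      unfolding g(3,6) face_eq_iff[OF i] using i by (simp_all add: cubes_upd)
    ultimately show "(x, z) \<in> face_rel S i R" unfolding face_rel_def by blast
  qed
qed

text \<open>In this form each closure condition asks for membership of a cube computed explicitly
  from given members, so the conditions pass to the intersection that defines
  \<open>Delta\<close>.\<close>

lemma dimcon_iff:
  "dimcon ar B G S R \<longleftrightarrow> is_subuniv_pow ar B G (cubes S) R \<and>
    (\<forall>\<gamma>\<in>R. \<forall>i\<in>S. \<forall>j\<in>{0, 1}. (\<lambda>f\<in>cubes S. \<gamma> (f(i := j))) \<in> R) \<and>
    (\<forall>\<gamma>\<in>R. \<forall>i\<in>S. (\<lambda>f\<in>cubes S. \<gamma> (f(i := 1 - f i))) \<in> R) \<and>
    (\<forall>i\<in>S. \<forall>\<gamma>\<in>R. \<forall>\<gamma>'\<in>R. (\<forall>f\<in>cubes S. \<gamma> (f(i := 1)) = \<gamma>' (f(i := 0))) \<longrightarrow>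
      (\<lambda>f\<in>cubes S. if f i = 0 then \<gamma> f else \<gamma>' f) \<in> R)"
proof (cases "R \<subseteq> cubes S \<rightarrow>\<^sub>E B")
  case True
  then have "(\<forall>i\<in>S. trans (face_rel S i R)) \<longleftrightarrow> (\<forall>i\<in>S. \<forall>\<gamma>\<in>R. \<forall>\<gamma>'\<in>R.
      (\<forall>f\<in>cubes S. \<gamma> (f(i := 1)) = \<gamma>' (f(i := 0))) \<longrightarrow>
      (\<lambda>f\<in>cubes S. if f i = 0 then \<gamma> f else \<gamma>' f) \<in> R)"
    by (intro ball_cong refl trans_face_rel_iff)
  then show ?thesis unfolding dimcon_def refl_c_eq by (auto simp: sym_c_eq)
next
  case False
  then show ?thesis by (auto simp: dimcon_def is_subuniv_pow_def)
qed

section \<open>Closure properties of higher-dimensional congruences and of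
  \<open>Delta\<close>\<close>

lemma dimcon_subset: "dimcon ar B G S R \<Longrightarrow> R \<subseteq> cubes S \<rightarrow>\<^sub>E B"
  by (simp add: dimcon_def is_subuniv_pow_def)

lemma dimcon_refl:
  "dimcon ar B G S R \<Longrightarrow> \<gamma> \<in> R \<Longrightarrow> i \<in> S \<Longrightarrow> j \<in> {0, 1} \<Longrightarrow> (\<lambda>f\<in>cubes S. \<gamma> (f(i := j))) \<in> R"
  unfolding dimcon_iff by blast

lemma dimcon_sym:
  "dimcon ar B G S R \<Longrightarrow> \<gamma> \<in> R \<Longrightarrow> i \<in> S \<Longrightarrow> (\<lambda>f\<in>cubes S. \<gamma> (f(i := 1 - f i))) \<in> R"
  unfolding dimcon_iff by simp

lemma dimcon_trans:
  assumes "dimcon ar B G S R" "i \<in> S" "\<gamma> \<in> R" "\<gamma>' \<in> R"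
    "\<And>f. f \<in> cubes S \<Longrightarrow> \<gamma> (f(i := 1)) = \<gamma>' (f(i := 0))"
  shows "(\<lambda>f\<in>cubes S. if f i = 0 then \<gamma> f else \<gamma>' f) \<in> R"
  using assms unfolding dimcon_iff by simp

lemma dimcon_op:
  "dimcon ar B G S R \<Longrightarrow> length xs = ar f \<Longrightarrow> set xs \<subseteq> R \<Longrightarrow> pw_op G (cubes S) f xs \<in> R"
  unfolding dimcon_def is_subuniv_pow_def by simp

text \<open>This is the member of the intersected family that confines \<open>Delta\<close> to cubes
  over \<open>B\<close>.\<close>

lemma dimcon_full:
  assumes "is_alg ar B G"
  shows "dimcon ar B G S (cubes S \<rightarrow>\<^sub>E B)"
  unfolding dimcon_iff
  using pw_op_closed[OF assms]
  by (auto simp: is_subuniv_pow_def PiE_iff cubes_upd cubes_flip[simplified])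

lemma Mgen_subset:
  assumes "is_subuniv_pow ar B G (cubes S) R"
    "\<And>k x y. k \<in> S \<Longrightarrow> (x, y) \<in> \<theta> k \<Longrightarrow> cube S k x y \<in> R"
  shows "Mgen ar B G S \<theta> \<subseteq> R"
  unfolding Mgen_def gen_pow_def using assms by (intro Inter_lower) auto

lemma Delta_minimal:
  assumes "dimcon ar B G S R" "\<And>k x y. k \<in> S \<Longrightarrow> (x, y) \<in> \<theta> k \<Longrightarrow> cube S k x y \<in> R"
  shows "Delta ar B G S \<theta> \<subseteq> R"
proof -
  have "Mgen ar B G S \<theta> \<subseteq> R" using assms by (intro Mgen_subset) (auto simp: dimcon_def)
  then show ?thesis unfolding Delta_def using assms(1) by (intro Inter_lower) simp
qed

lemma cube_in_Delta:
  assumes "k \<in> S" "(x, y) \<in> \<theta> k"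
  shows "cube S k x y \<in> Delta ar B G S \<theta>"
proof -
  have "cube S k x y \<in> Mgen ar B G S \<theta>"
    unfolding Mgen_def gen_pow_def using assms by blast
  then show ?thesis unfolding Delta_def by blast
qed

lemma dimcon_Delta:
  assumes "is_alg ar B G" "\<And>k. k \<in> S \<Longrightarrow> \<theta> k \<subseteq> B \<times> B"
  shows "dimcon ar B G S (Delta ar B G S \<theta>)"
proof -
  have sub: "Delta ar B G S \<theta> \<subseteq> cubes S \<rightarrow>\<^sub>E B"
    using assms(2) by (intro Delta_minimal dimcon_full assms(1)) (fastforce simp: cube_def)
  have mem: "x \<in> Delta ar B G S \<theta> \<longleftrightarrow> (\<forall>R. dimcon ar B G S R \<and> Mgen ar B G S \<theta> \<subseteq> R \<longrightarrow> x \<in> R)" for x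
    by (auto simp: Delta_def)
  show ?thesis
    unfolding dimcon_iff is_subuniv_pow_def
  proof (intro conjI sub ballI allI impI)
    fix f xs assume "length xs = ar f \<and> set xs \<subseteq> Delta ar B G S \<theta>"
    then show "pw_op G (cubes S) f xs \<in> Delta ar B G S \<theta>"
      unfolding mem by (auto intro!: dimcon_op simp: mem subset_iff)
  next
    fix \<gamma> i assume g: "\<gamma> \<in> Delta ar B G S \<theta>" and i: "i \<in> S"
    show "(\<lambda>f\<in>cubes S. \<gamma> (f(i := 1 - f i))) \<in> Delta ar B G S \<theta>"
      unfolding mem
    proof (intro allI impI)
      fix R assume R: "dimcon ar B G S R \<and> Mgen ar B G S \<theta> \<subseteq> R"
      then have "\<gamma> \<in> R" using g unfolding mem by blast
      with R i show "(\<lambda>f\<in>cubes S. \<gamma> (f(i := 1 - f i))) \<in> R" by (intro dimcon_sym[OF conjunct1[OF R]])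
    qed
  next
    fix i \<gamma> \<gamma>' assume i: "i \<in> S" and g: "\<gamma> \<in> Delta ar B G S \<theta>" "\<gamma>' \<in> Delta ar B G S \<theta>"
      and eq: "\<forall>f\<in>cubes S. \<gamma> (f(i := 1)) = \<gamma>' (f(i := 0))"
    show "(\<lambda>f\<in>cubes S. if f i = 0 then \<gamma> f else \<gamma>' f) \<in> Delta ar B G S \<theta>"
      unfolding mem
    proof (intro allI impI)
      fix R assume R: "dimcon ar B G S R \<and> Mgen ar B G S \<theta> \<subseteq> R"
      then have "\<gamma> \<in> R" "\<gamma>' \<in> R" using g unfolding mem by blast+
      with i eq show "(\<lambda>f\<in>cubes S. if f i = 0 then \<gamma> f else \<gamma>' f) \<in> R"
        by (intro dimcon_trans[OF conjunct1[OF R]]) auto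
    qed
  qed (unfold mem, use dimcon_refl in blast)
qed

text \<open>Adding a dummy direction: the cubes over \<^term>\<open>S - {i}\<close> whose degenerate extension
  lies in the larger congruence form a congruence themselves.\<close>

lemma Delta_degenerate:
  assumes alg: "is_alg ar B G" and th: "\<And>k. k \<in> S \<Longrightarrow> \<theta> k \<subseteq> B \<times> B" and i: "i \<in> S"
    and z: "\<zeta> \<in> Delta ar B G (S - {i}) \<theta>"
  shows "(\<lambda>f\<in>cubes S. \<zeta> (f(i := undefined))) \<in> Delta ar B G S \<theta>"
proof -
  let ?T = "S - {i}" and ?D = "Delta ar B G S \<theta>"
  define e where "e \<zeta> = (\<lambda>f\<in>cubes S. \<zeta> (f(i := undefined)))" for \<zeta> :: "(nat \<Rightarrow> nat) \<Rightarrow> 'b"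
  have D: "dimcon ar B G S ?D" by (rule dimcon_Delta[OF alg th])
  let ?R = "{\<zeta> \<in> cubes ?T \<rightarrow>\<^sub>E B. e \<zeta> \<in> ?D}"
  note full = dimcon_full[OF alg, of ?T]
  have "dimcon ar B G ?T ?R"
    unfolding dimcon_iff is_subuniv_pow_def
  proof (intro conjI ballI allI impI CollectI)
    fix f xs assume *: "length xs = ar f \<and> set xs \<subseteq> ?R"
    show "pw_op G (cubes ?T) f xs \<in> cubes ?T \<rightarrow>\<^sub>E B" using * by (intro dimcon_op[OF full]) auto
    have "e (pw_op G (cubes ?T) f xs) = pw_op G (cubes S) f (map e xs)"
      by (rule ext) (simp add: e_def pw_op_def restrict_def cubes_del o_def)
    also have "\<dots> \<in> ?D" using * by (intro dimcon_op[OF D]) auto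
    finally show "e (pw_op G (cubes ?T) f xs) \<in> ?D" .
  next
    fix \<gamma> k and j :: nat assume g: "\<gamma> \<in> ?R" and k: "k \<in> ?T" and j: "j \<in> {0, 1}"
    show "(\<lambda>f\<in>cubes ?T. \<gamma> (f(k := j))) \<in> cubes ?T \<rightarrow>\<^sub>E B" using g k j by (intro dimcon_refl[OF full]) auto
    have "e (\<lambda>f\<in>cubes ?T. \<gamma> (f(k := j))) = (\<lambda>f\<in>cubes S. e \<gamma> (f(k := j)))"
      using k j by (intro ext) (auto simp: e_def restrict_def cubes_del cubes_upd fun_upd_twist)
    also have "\<dots> \<in> ?D" using g k j by (intro dimcon_refl[OF D]) auto
    finally show "e (\<lambda>f\<in>cubes ?T. \<gamma> (f(k := j))) \<in> ?D" .
  next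
    fix \<gamma> k assume g: "\<gamma> \<in> ?R" and k: "k \<in> ?T"
    show "(\<lambda>f\<in>cubes ?T. \<gamma> (f(k := 1 - f k))) \<in> cubes ?T \<rightarrow>\<^sub>E B" using g k by (intro dimcon_sym[OF full]) auto
    have "e (\<lambda>f\<in>cubes ?T. \<gamma> (f(k := 1 - f k))) = (\<lambda>f\<in>cubes S. e \<gamma> (f(k := 1 - f k)))"
      using k cubes_flip[of _ S k]
      by (intro ext) (auto simp: e_def restrict_def cubes_del fun_upd_twist)
    also have "\<dots> \<in> ?D" using g k by (intro dimcon_sym[OF D]) auto
    finally show "e (\<lambda>f\<in>cubes ?T. \<gamma> (f(k := 1 - f k))) \<in> ?D" .
  next
    fix k \<gamma> \<gamma>' assume k: "k \<in> ?T" and g: "\<gamma> \<in> ?R" "\<gamma>' \<in> ?R"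
      and eq: "\<forall>f\<in>cubes ?T. \<gamma> (f(k := 1)) = \<gamma>' (f(k := 0))"
    show "(\<lambda>f\<in>cubes ?T. if f k = 0 then \<gamma> f else \<gamma>' f) \<in> cubes ?T \<rightarrow>\<^sub>E B"
      using g k eq by (intro dimcon_trans[OF full]) auto
    have "e (\<lambda>f\<in>cubes ?T. if f k = 0 then \<gamma> f else \<gamma>' f) = (\<lambda>f\<in>cubes S. if f k = 0 then e \<gamma> f else e \<gamma>' f)"
      using k by (intro ext) (auto simp: e_def restrict_def cubes_del)
    also have "\<dots> \<in> ?D"
    proof (rule dimcon_trans[OF D])
      fix f assume f: "f \<in> cubes S"
      then have "\<gamma> (f(i := undefined, k := 1)) = \<gamma>' (f(i := undefined, k := 0))"
        using eq cubes_del by blast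
      then show "e \<gamma> (f(k := 1)) = e \<gamma>' (f(k := 0))"
        using f k by (simp add: e_def cubes_upd fun_upd_twist)
    qed (use g k in auto)
    finally show "e (\<lambda>f\<in>cubes ?T. if f k = 0 then \<gamma> f else \<gamma>' f) \<in> ?D" .
  qed auto
  moreover have "cube ?T k x y \<in> ?R" if "k \<in> ?T" "(x, y) \<in> \<theta> k" for k x y
  proof -
    have "e (cube ?T k x y) = cube S k x y"
      using that by (intro ext) (auto simp: e_def cube_def restrict_def cubes_del)
    then show ?thesis using that cube_in_Delta[of k S x y \<theta>] th[of k]
      by (auto simp: cube_def)
  qed
  ultimately have "Delta ar B G ?T \<theta> \<subseteq> ?R" by (rule Delta_minimal)
  then show ?thesis using z unfolding e_def by auto
qed

text \<open>Turns a hypothesis on a face into one on a degenerate cube over \<open>S\<close>, so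
  that the remaining argument stays inside a single congruence.\<close>

lemma Delta_face:
  assumes "is_alg ar B G" "\<And>k. k \<in> S \<Longrightarrow> \<theta> k \<subseteq> B \<times> B" "i \<in> S"
    and "face S i j \<gamma> \<in> Delta ar B G (S - {i}) \<theta>"
  shows "(\<lambda>f\<in>cubes S. \<gamma> (f(i := j))) \<in> Delta ar B G S \<theta>"
proof -
  have "(\<lambda>f\<in>cubes S. face S i j \<gamma> (f(i := undefined))) = (\<lambda>f\<in>cubes S. \<gamma> (f(i := j)))"
    by (rule ext) (simp add: face_def cubes_del restrict_def)
  then show ?thesis using Delta_degenerate[OF assms] by simp
qed

lemma in_variety_pow:
  assumes v: "in_variety ar E B G" and R: "is_subuniv_pow ar B G I R" "R \<noteq> {}"
  shows "in_variety ar E R (pw_op G I)"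
  unfolding in_variety_def
proof (intro conjI)
  show "is_alg ar R (pw_op G I)" using R by (simp add: is_alg_def is_subuniv_pow_def)
  show "\<forall>(s, t)\<in>E. \<forall>\<rho>. (\<forall>i. \<rho> i \<in> R) \<longrightarrow> tev (pw_op G I) \<rho> s = tev (pw_op G I) \<rho> t"
  proof safe
    fix s t and \<rho> :: "nat \<Rightarrow> _" assume E: "(s, t) \<in> E" and \<rho>: "\<forall>i. \<rho> i \<in> R"
    have \<rho>': "\<rho> k \<in> I \<rightarrow>\<^sub>E B" for k using \<rho> R by (auto simp: is_subuniv_pow_def)
    \<comment> \<open>Variables have extensional values and \<open>pw_op\<close> restricts to
      \<open>I\<close>, so only coordinates in \<open>I\<close> carry information.\<close>
    have out: "tev (pw_op G I) \<rho> u x = undefined" if "x \<notin> I" for u x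
      using that \<rho>' by (cases u) (auto simp: pw_op_def PiE_iff extensional_def)
    have in_I: "tev (pw_op G I) \<rho> u x = tev G (\<lambda>k. \<rho> k x) u" if "x \<in> I" for u x
      using that by (intro tev_hom[of "\<lambda>g. g x"]) (simp add: pw_op_def)
    show "tev (pw_op G I) \<rho> s = tev (pw_op G I) \<rho> t"
    proof
      fix x
      show "tev (pw_op G I) \<rho> s x = tev (pw_op G I) \<rho> t x"
      proof (cases "x \<in> I")
        case True
        then have "tev G (\<lambda>k. \<rho> k x) s = tev G (\<lambda>k. \<rho> k x) t"
          using \<rho>' by (intro in_varietyD[OF v E]) auto
        then show ?thesis by (simp add: in_I True)
      qed (simp add: out)
    qed
  qed
qed

text \<open>An encoding of pairs, which makes the hypotheses at one type available for algebras of pairs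
  and of quadruples.\<close>

definition fun_pair :: "((nat \<Rightarrow> nat) \<Rightarrow> 'a) \<times> ((nat \<Rightarrow> nat) \<Rightarrow> 'a) \<Rightarrow> (nat \<Rightarrow> nat) \<Rightarrow> 'a" where
  "fun_pair p f = (if f 0 = 0 then fst p (\<lambda>k. f (Suc k)) else snd p (\<lambda>k. f (Suc k)))"

lemma inj_fun_pair: "inj fun_pair"
proof (rule injI)
  fix p p' :: "((nat \<Rightarrow> nat) \<Rightarrow> 'a) \<times> ((nat \<Rightarrow> nat) \<Rightarrow> 'a)"
  assume *: "fun_pair p = fun_pair p'"
  have "fst p f = fst p' f" "snd p f = snd p' f" for f
    using fun_cong[OF *, of "case_nat 0 f"] fun_cong[OF *, of "case_nat 1 f"]
    by (simp_all add: fun_pair_def)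
  then show "p = p'" by (auto simp: prod_eq_iff)
qed

section \<open>Two-dimensional sections of a higher-dimensional congruence\<close>

definition sq :: "nat set \<Rightarrow> nat \<Rightarrow> nat \<Rightarrow> ((nat \<Rightarrow> nat) \<Rightarrow> 'a) \<Rightarrow> ((nat \<Rightarrow> nat) \<Rightarrow> 'a) \<Rightarrow>
    ((nat \<Rightarrow> nat) \<Rightarrow> 'a) \<Rightarrow> ((nat \<Rightarrow> nat) \<Rightarrow> 'a) \<Rightarrow> (nat \<Rightarrow> nat) \<Rightarrow> 'a" where
  "sq S i m a b c d = (\<lambda>f\<in>cubes S. if f m = 0 then (if f i = 0 then a f else b f)
     else (if f i = 0 then c f else d f))"

text \<open>Cubes over \<open>S - {i, m}\<close> are represented by their constant extensions to
  \<open>S\<close>. All corners of a square then share one index set, and \<open>sq\<close> can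
  assemble them into a cube over \<open>S\<close>.\<close>

definition const2 :: "nat set \<Rightarrow> nat \<Rightarrow> nat \<Rightarrow> ((nat \<Rightarrow> nat) \<Rightarrow> 'a) set \<Rightarrow> ((nat \<Rightarrow> nat) \<Rightarrow> 'a) set" where
  "const2 S i m R = {x \<in> R. \<forall>f\<in>cubes S. \<forall>j\<in>{0, 1}. x (f(i := j)) = x f \<and> x (f(m := j)) = x f}"

definition sqrel :: "nat set \<Rightarrow> nat \<Rightarrow> nat \<Rightarrow> ((nat \<Rightarrow> nat) \<Rightarrow> 'a) set \<Rightarrow> ((nat \<Rightarrow> nat) \<Rightarrow> 'a) \<Rightarrow>
    ((nat \<Rightarrow> nat) \<Rightarrow> 'a) \<Rightarrow> ((nat \<Rightarrow> nat) \<Rightarrow> 'a) \<Rightarrow> ((nat \<Rightarrow> nat) \<Rightarrow> 'a) \<Rightarrow> bool" where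
  "sqrel S i m R a b c d \<longleftrightarrow> {a, b, c, d} \<subseteq> const2 S i m R \<and> sq S i m a b c d \<in> R"

lemma const2_upd:
  assumes "x \<in> const2 S i m R" "f \<in> cubes S"
  shows "x (f(i := 0)) = x f" "x (f(i := 1)) = x f" "x (f(m := 0)) = x f" "x (f(m := 1)) = x f"
  using assms unfolding const2_def by auto

lemma sq_refl0:
  assumes "i \<in> S" "i \<noteq> m" "{a, b, c, d} \<subseteq> const2 S i m R" 
  shows "(\<lambda>f\<in>cubes S. sq S i m a b c d (f(i := 0))) = sq S i m a a c c"
    "(\<lambda>f\<in>cubes S. sq S i m a b c d (f(i := 1))) = sq S i m b b d d"
  using assms by (auto simp: sq_def restrict_def cubes_upd const2_upd[of _ S i m R, simplified] intro!: ext)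

lemma sq_refl1:
  assumes "m \<in> S" "i \<noteq> m" "{a, b, c, d} \<subseteq> const2 S i m R"
  shows "(\<lambda>f\<in>cubes S. sq S i m a b c d (f(m := 0))) = sq S i m a b a b"
    "(\<lambda>f\<in>cubes S. sq S i m a b c d (f(m := 1))) = sq S i m c d c d"
  using assms by (auto simp: sq_def restrict_def cubes_upd const2_upd[of _ S i m R, simplified] intro!: ext)

lemma is_subuniv_const2:
  assumes D: "dimcon ar B G S R" and im: "i \<in> S" "m \<in> S"
  shows "is_subuniv_pow ar B G (cubes S) (const2 S i m R)"
  unfolding is_subuniv_pow_def
proof (intro conjI allI impI)
  show "const2 S i m R \<subseteq> cubes S \<rightarrow>\<^sub>E B" using dimcon_subset[OF D] by (auto simp: const2_def)
  fix f xs assume *: "length xs = ar f \<and> set xs \<subseteq> const2 S i m R"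
  have "G f (map (\<lambda>x. x (g(k := j))) xs) = G f (map (\<lambda>x. x g) xs)" if "g \<in> cubes S" "j \<in> {0, 1}" "k = i \<or> k = m" for g j k
    using * that by (intro arg_cong[of _ _ "G f"] map_cong refl) (auto simp: const2_def)
  then have "pw_op G (cubes S) f xs (g(k := j)) = pw_op G (cubes S) f xs g"
    if "g \<in> cubes S" "j \<in> {0, 1}" "k = i \<or> k = m" for g j k
    using that im cubes_upd[OF that(1) _ that(2), of k] by (auto simp: pw_op_def)
  moreover have "pw_op G (cubes S) f xs \<in> R" using * by (intro dimcon_op[OF D]) (auto simp: const2_def)
  ultimately show "pw_op G (cubes S) f xs \<in> const2 S i m R" unfolding const2_def by blast
qed

text \<open>Direction 0 of the square is \<open>i\<close> and direction 1 is \<open>m\<close>.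
  Degeneration, reflection and gluing of the assembled cube act on its corners as the axioms
  prescribe, because the corners are constant in both directions.\<close>

lemma square_congruence_sqrel:
  fixes R :: "((nat \<Rightarrow> nat) \<Rightarrow> 'a) set"
  assumes cm: "cong_modular_var ar E TYPE((nat \<Rightarrow> nat) \<Rightarrow> 'a)"
    and ki: "kiss_term ar E q TYPE((nat \<Rightarrow> nat) \<Rightarrow> 'a)"
    and v: "in_variety ar E B G" and D: "dimcon ar B G S R" and ne: "const2 S i m R \<noteq> {}"
    and im: "i \<in> S" "m \<in> S" "i \<noteq> m"
  shows "square_congruence ar E q (const2 S i m R) (pw_op G (cubes S)) (sqrel S i m R) fun_pair"
proof
  show "in_variety ar E (const2 S i m R) (pw_op G (cubes S))"
    by (rule in_variety_pow[OF v is_subuniv_const2[OF D im(1,2)] ne])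
  fix a b c d :: "(nat \<Rightarrow> nat) \<Rightarrow> 'a"
  {
    assume a: "sqrel S i m R a b c d"
    then have C: "{a, b, c, d} \<subseteq> const2 S i m R" and s: "sq S i m a b c d \<in> R"
      by (auto simp: sqrel_def)
    show "a \<in> const2 S i m R \<and> b \<in> const2 S i m R \<and> c \<in> const2 S i m R \<and> d \<in> const2 S i m R"
      using C by auto
    show "sqrel S i m R a b a b \<and> sqrel S i m R c d c d \<and> sqrel S i m R a a c c \<and> sqrel S i m R b b d d"
      using C dimcon_refl[OF D s im(1), of 0] dimcon_refl[OF D s im(1), of 1]
        dimcon_refl[OF D s im(2), of 0] dimcon_refl[OF D s im(2), of 1]
      unfolding sqrel_def sq_refl0[OF im(1,3) C] sq_refl1[OF im(2,3) C] by auto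
    have "(\<lambda>f\<in>cubes S. sq S i m a b c d (f(i := 1 - f i))) = sq S i m b a d c"
      using C im by (intro ext) (auto simp: sq_def restrict_def cubes_upd
        const2_upd[of _ S i m R, simplified] dest: cubes_val[of _ S i])
    then show "sqrel S i m R b a d c" using C dimcon_sym[OF D s im(1)] by (auto simp: sqrel_def)
    have "(\<lambda>f\<in>cubes S. sq S i m a b c d (f(m := 1 - f m))) = sq S i m c d a b"
      using C im by (intro ext) (auto simp: sq_def restrict_def cubes_upd
        const2_upd[of _ S i m R, simplified] dest: cubes_val[of _ S m])
    then show "sqrel S i m R c d a b" using C dimcon_sym[OF D s im(2)] by (auto simp: sqrel_def)
    fix e g
    {
      assume a': "sqrel S i m R b e d g"
      then have C': "{b, e, d, g} \<subseteq> const2 S i m R" and s': "sq S i m b e d g \<in> R"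
        by (auto simp: sqrel_def)
      have "(\<lambda>f\<in>cubes S. if f i = 0 then sq S i m a b c d f else sq S i m b e d g f) \<in> R"
        by (rule dimcon_trans[OF D im(1) s s'])
          (use C C' im in \<open>auto simp: sq_def cubes_upd const2_upd[of _ S i m R, simplified]\<close>)
      moreover have "(\<lambda>f\<in>cubes S. if f i = 0 then sq S i m a b c d f else sq S i m b e d g f) = sq S i m a e c g"
        by (intro ext) (auto simp: sq_def restrict_def)
      ultimately show "sqrel S i m R a e c g" using C C' by (auto simp: sqrel_def)
    }
    {
      assume a': "sqrel S i m R c d e g"
      then have C': "{c, d, e, g} \<subseteq> const2 S i m R" and s': "sq S i m c d e g \<in> R"
        by (auto simp: sqrel_def)
      have "(\<lambda>f\<in>cubes S. if f m = 0 then sq S i m a b c d f else sq S i m c d e g f) \<in> R"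
        by (rule dimcon_trans[OF D im(2) s s'])
          (use C C' im in \<open>auto simp: sq_def cubes_upd const2_upd[of _ S i m R, simplified]\<close>)
      moreover have "(\<lambda>f\<in>cubes S. if f m = 0 then sq S i m a b c d f else sq S i m c d e g f) = sq S i m a b e g"
        by (intro ext) (auto simp: sq_def restrict_def)
      ultimately show "sqrel S i m R a b e g" using C C' by (auto simp: sqrel_def)
    }
  }
next
  fix x assume x: "x \<in> const2 S i m R"
  then have "x \<in> cubes S \<rightarrow>\<^sub>E B" "x \<in> R" using dimcon_subset[OF D] by (auto simp: const2_def)
  then have "sq S i m x x x x = x" by (intro ext) (auto simp: sq_def restrict_def PiE_iff extensional_def)
  then show "sqrel S i m R x x x x" using x \<open>x \<in> R\<close> by (simp add: sqrel_def)
next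
  show "compat4 ar (pw_op G (cubes S)) (sqrel S i m R)"
    unfolding compat4_def
  proof (intro allI impI)
    fix f a b c d assume *: "\<forall>k<ar f. sqrel S i m R (a k) (b k) (c k) (d k)"
    have C: "pw_op G (cubes S) f (map x [0..<ar f]) \<in> const2 S i m R"
      if "\<forall>k<ar f. x k \<in> const2 S i m R" for x
      using that is_subuniv_const2[OF D im(1,2)] unfolding is_subuniv_pow_def by (simp add: image_subset_iff)
    let ?p = "\<lambda>x. pw_op G (cubes S) f (map x [0..<ar f])"
    have "sq S i m (?p a) (?p b) (?p c) (?p d) = ?p (\<lambda>k. sq S i m (a k) (b k) (c k) (d k))"
      by (intro ext) (auto simp: sq_def pw_op_def restrict_def o_def)
    also have "\<dots> \<in> R" using * by (intro dimcon_op[OF D]) (auto simp: sqrel_def)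
    finally show "sqrel S i m R (?p a) (?p b) (?p c) (?p d)"
      using * C unfolding sqrel_def by auto
  qed
qed (fact cm ki inj_fun_pair)+

subsection \<open>Iterated Kiss terms\<close>

text \<open>Cut along \<open>i\<close> and \<open>m\<close>, the cubes \<eta> and \<gamma> become
  squares with a common edge at \<open>i = 0\<close>. The square between their edges at
  \<open>i = 1\<close> has all its sides in the congruence, so \<open>square_completion\<close>
  corrects its last corner; gluing it to \<eta> gives the cube claimed.\<close>

lemma dimcon_completion:
  fixes \<gamma> :: "(nat \<Rightarrow> nat) \<Rightarrow> 'a"
  assumes cm: "cong_modular_var ar E TYPE((nat \<Rightarrow> nat) \<Rightarrow> 'a)"
    and ki: "kiss_term ar E q TYPE((nat \<Rightarrow> nat) \<Rightarrow> 'a)"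
    and v: "in_variety ar E B G" and D: "dimcon ar B G S R"
    and im: "i \<in> S" "m \<in> S" "i \<noteq> m"
    and \<eta>: "\<eta> \<in> R" "\<And>f. f \<in> cubes S \<Longrightarrow> f i = 0 \<Longrightarrow> \<eta> f = \<gamma> f"
    and \<gamma>: "(\<lambda>f\<in>cubes S. \<gamma> (f(i := 1))) \<in> R"
      "(\<lambda>f\<in>cubes S. \<gamma> (f(m := 0))) \<in> R" "(\<lambda>f\<in>cubes S. \<gamma> (f(m := 1))) \<in> R"
  shows "(\<lambda>f\<in>cubes S. if f i = 1 \<and> f m = 1
    then evl G [\<eta> (f(m := 0)), \<gamma> (f(m := 0)), \<eta> f, \<gamma> f] q else \<gamma> f) \<in> R"
proof -
  define Q where "Q a b x = (\<lambda>f\<in>cubes S. x (f(i := a, m := b)))"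
    for a b and x :: "(nat \<Rightarrow> nat) \<Rightarrow> 'a"
  note upd = cubes_upd[OF cubes_upd[OF _ im(1)] im(2)]
  have Q_const: "Q a b x \<in> const2 S i m R" if "Q a b x \<in> R" "a \<in> {0, 1}" "b \<in> {0, 1}" for a b x
    using that im upd cubes_upd[of _ S i] cubes_upd[of _ S m]
    by (auto simp: const2_def Q_def fun_upd_twist[of i m])
  have Q_refl: "Q a b x = (\<lambda>f\<in>cubes S. (\<lambda>f\<in>cubes S. x (f(i := a))) (f(m := b)))" if "b \<in> {0, 1}" for a b x
    using that im by (intro ext) (auto simp: Q_def restrict_def cubes_upd fun_upd_twist)
  have Q\<eta>: "Q a b \<eta> \<in> const2 S i m R" if "a \<in> {0, 1}" "b \<in> {0, 1}" for a b
  proof (rule Q_const)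
    show "Q a b \<eta> \<in> R" unfolding Q_refl[OF that(2)] by (intro dimcon_refl[OF D] \<eta> im that)
  qed fact+
  have Q\<gamma>: "Q 1 b \<gamma> \<in> const2 S i m R" if "b \<in> {0, 1}" for b
  proof (rule Q_const)
    show "Q 1 b \<gamma> \<in> R" unfolding Q_refl[OF that] by (intro dimcon_refl[OF D] \<gamma> im that)
  qed (use that in auto)
  interpret square_congruence ar E q "const2 S i m R" "pw_op G (cubes S)" "sqrel S i m R" fun_pair
    using Q\<eta>[of 0 0] by (intro square_congruence_sqrel[OF cm ki v D _ im]) auto
  let ?D = "sqrel S i m R"
  \<comment> \<open>The letters \<open>p\<close> and \<open>r\<close> mark the quarters of \<eta>
    with \<open>m = 0\<close> and \<open>m = 1\<close>, indexed by the value at \<open>i\<close>;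
    \<open>?q\<close> and \<open>?s\<close> are the quarters of \<gamma> at
    \<open>i = 1\<close>.\<close>
  let ?p0 = "Q 0 0 \<eta>" and ?p1 = "Q 1 0 \<eta>" and ?r0 = "Q 0 1 \<eta>" and ?r1 = "Q 1 1 \<eta>"
    and ?q = "Q 1 0 \<gamma>" and ?s = "Q 1 1 \<gamma>"
  have \<eta>_out: "\<eta> f = undefined" if "f \<notin> cubes S" for f
    using that \<eta>(1) dimcon_subset[OF D] by (auto simp: PiE_iff extensional_def)
  note simps = sq_def Q_def restrict_def fun_upd_idem im fun_upd_twist[of i m]
  have \<eta>0: "\<eta> (f(m := j)) = \<gamma> (f(m := j))" if "f \<in> cubes S" "f i = 0" "j \<in> {0, 1}" for f j
    using that im by (intro \<eta>(2) cubes_upd) auto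
  have 1: "f i = 1" if "f \<in> cubes S" "f i \<noteq> 0" for f using cubes_val[OF that(1) im(1)] that by auto
  have 2: "f m = 1" if "f \<in> cubes S" "f m \<noteq> 0" for f using cubes_val[OF that(1) im(2)] that by auto
  have "sq S i m ?p0 ?p1 ?p0 ?p1 = (\<lambda>f\<in>cubes S. \<eta> (f(m := 0)))"
    by (intro ext) (auto simp: simps 1)
  then have pp: "?D ?p0 ?p1 ?p0 ?p1"
    using Q\<eta> dimcon_refl[OF D \<eta>(1) im(2), of 0] by (simp add: sqrel_def)
  have "sq S i m ?p0 ?q ?p0 ?q = (\<lambda>f\<in>cubes S. \<gamma> (f(m := 0)))"
    using \<eta>0 by (intro ext) (auto simp: simps 1)
  then have pq: "?D ?p0 ?q ?p0 ?q" using Q\<eta> Q\<gamma> \<gamma>(2) by (simp add: sqrel_def)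
  have "sq S i m ?r0 ?r1 ?r0 ?r1 = (\<lambda>f\<in>cubes S. \<eta> (f(m := 1)))"
    by (intro ext) (auto simp: simps 1)
  then have rr: "?D ?r0 ?r1 ?r0 ?r1"
    using Q\<eta> dimcon_refl[OF D \<eta>(1) im(2), of 1] by (simp add: sqrel_def)
  have "sq S i m ?r0 ?s ?r0 ?s = (\<lambda>f\<in>cubes S. \<gamma> (f(m := 1)))"
    using \<eta>0 by (intro ext) (auto simp: simps 1)
  then have rs: "?D ?r0 ?s ?r0 ?s" using Q\<eta> Q\<gamma> \<gamma>(3) by (simp add: sqrel_def)
  have "sq S i m ?p1 ?p1 ?r1 ?r1 = (\<lambda>f\<in>cubes S. \<eta> (f(i := 1)))"
    by (intro ext) (auto simp: simps 2)
  then have pr: "?D ?p1 ?p1 ?r1 ?r1"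
    using Q\<eta> dimcon_refl[OF D \<eta>(1) im(1), of 1] by (simp add: sqrel_def)
  have "sq S i m ?q ?q ?s ?s = (\<lambda>f\<in>cubes S. \<gamma> (f(i := 1)))"
    by (intro ext) (auto simp: simps 2)
  then have qs: "?D ?q ?q ?s ?s" using Q\<gamma> \<gamma>(1) by (simp add: sqrel_def)
  have "sq S i m ?p0 ?p1 ?r0 ?r1 = \<eta>"
    by (intro ext) (auto simp: simps 1 2 \<eta>_out)
  then have \<eta>D: "?D ?p0 ?p1 ?r0 ?r1" using Q\<eta> \<eta>(1) by (simp add: sqrel_def)
  define e where "e = evl (pw_op G (cubes S)) [?p1, ?q, ?r1, ?s] q"
  \<comment> \<open>The edge from \<open>?p1\<close> to \<open>?q\<close> passes through
    \<open>?p0\<close>, and the one from \<open>?r1\<close> to \<open>?s\<close> through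
    \<open>?r0\<close>.\<close>
  have "?D ?p1 ?q ?r1 e"
    unfolding e_def using D_trans0[OF D_sym0[OF pp] pq] D_trans0[OF D_sym0[OF rr] rs] pr qs
    by (rule square_completion)
  with \<eta>D have "?D ?p0 ?q ?r0 e" by (rule D_trans0)
  then have "sq S i m ?p0 ?q ?r0 e \<in> R" by (simp add: sqrel_def)
  moreover have "e f = evl G [?p1 f, ?q f, ?r1 f, ?s f] q" if "f \<in> cubes S" for f
    using that ki evl_hom[of "\<lambda>x. x f" "pw_op G (cubes S)" G q "[?p1, ?q, ?r1, ?s]"]
    by (simp add: e_def pw_op_def kiss_term_def eval_nat_numeral)
  then have e: "e f = evl G [\<eta> (f(m := 0)), \<gamma> (f(m := 0)), \<eta> f, \<gamma> f] q"
    if "f \<in> cubes S" "f i = 1" "f m = 1" for f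
    using that by (simp add: Q_def fun_upd_idem)
  have "sq S i m ?p0 ?q ?r0 e = (\<lambda>f\<in>cubes S. if f i = 1 \<and> f m = 1
    then evl G [\<eta> (f(m := 0)), \<gamma> (f(m := 0)), \<eta> f, \<gamma> f] q else \<gamma> f)"
  proof (rule ext)
    fix f
    consider "f \<notin> cubes S" | "f \<in> cubes S" "f i = 0" | "f \<in> cubes S" "f i = 1" "f m = 0"
      | "f \<in> cubes S" "f i = 1" "f m = 1"
      using 1 2 by blast
    then show "sq S i m ?p0 ?q ?r0 e f = (\<lambda>f\<in>cubes S. if f i = 1 \<and> f m = 1
      then evl G [\<eta> (f(m := 0)), \<gamma> (f(m := 0)), \<eta> f, \<gamma> f] q else \<gamma> f) f"
    proof cases
      case 2
      then show ?thesis using \<eta>(2)[OF 2] cubes_val[OF 2(1) im(2)]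
        by (auto simp: sq_def Q_def fun_upd_idem)
    qed (auto simp: sq_def Q_def fun_upd_idem e)
  qed
  ultimately show ?thesis by simp
qed

text \<open>The cube \<open>khat G q m \<gamma>\<close> applies the term of dimension \<open>m + 1\<close>, with the projection
  to the first variable in dimension one, to all faces of \<open>\<gamma>\<close> in directions \<open>0, \<dots>, m\<close>.\<close>

fun khat :: "('f \<Rightarrow> 'a list \<Rightarrow> 'a) \<Rightarrow> 'f trm \<Rightarrow> nat \<Rightarrow> ((nat \<Rightarrow> nat) \<Rightarrow> 'a) \<Rightarrow> (nat \<Rightarrow> nat) \<Rightarrow> 'a" where
  "khat G q 0 \<gamma> f = \<gamma> (f(0 := 0))"
| "khat G q (Suc m) \<gamma> f = (if \<forall>i\<le>Suc m. f i = 1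
     then evl G [khat G q m \<gamma> (f(Suc m := 0)), \<gamma> (f(Suc m := 0)), khat G q m \<gamma> f, \<gamma> f] q else \<gamma> f)"

lemma khat_eq:
  assumes "f \<in> cubes S" "i \<in> S" "i \<le> m" "f i = 0"
  shows "khat G q m \<gamma> f = \<gamma> f"
  using assms by (cases m) (auto simp: fun_upd_idem)

text \<open>Each step completes in directions \<open>0\<close> and \<open>Suc m\<close>, with the
  cube of the previous stage as \<eta>; it agrees with \<gamma> where coordinate 0 vanishes. Stage 0
  is a degenerate cube, as the one-dimensional term is the first projection.\<close>

lemma khat_in_dimcon:
  fixes \<gamma> :: "(nat \<Rightarrow> nat) \<Rightarrow> 'a"
  assumes cm: "cong_modular_var ar E TYPE((nat \<Rightarrow> nat) \<Rightarrow> 'a)"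
    and ki: "kiss_term ar E q TYPE((nat \<Rightarrow> nat) \<Rightarrow> 'a)"
    and id: "\<And>x y. x \<in> B \<Longrightarrow> y \<in> B \<Longrightarrow> evl G [x, x, y, y] q = y"
    and v: "in_variety ar E B G" and D: "dimcon ar B G S R"
    and S: "{0..m} \<subseteq> S" and g: "\<gamma> \<in> cubes S \<rightarrow>\<^sub>E B"
    and \<gamma>: "\<And>i j. i \<le> m \<Longrightarrow> j \<in> {0, 1} \<Longrightarrow> (\<lambda>f\<in>cubes S. \<gamma> (f(i := j))) \<in> R"
  shows "restrict (khat G q m \<gamma>) (cubes S) \<in> R"
  using S \<gamma>
proof (induction m)
  case 0
  have "khat G q 0 \<gamma> = (\<lambda>f. \<gamma> (f(0 := 0)))" by (rule ext) simp
  moreover have "(\<lambda>f\<in>cubes S. \<gamma> (f(0 := 0))) \<in> R" by (rule 0(2)) auto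
  ultimately show ?case by (simp only:)
next
  case (Suc m)
  let ?\<eta> = "restrict (khat G q m \<gamma>) (cubes S)"
  have IH: "?\<eta> \<in> R" using Suc.prems by (intro Suc.IH) auto
  have S: "0 \<in> S" "Suc m \<in> S" "0 \<noteq> Suc m" using Suc.prems(1) by auto
  have "(\<lambda>f\<in>cubes S. if f 0 = 1 \<and> f (Suc m) = 1
    then evl G [?\<eta> (f(Suc m := 0)), \<gamma> (f(Suc m := 0)), ?\<eta> f, \<gamma> f] q else \<gamma> f) \<in> R"
  proof (rule dimcon_completion[OF cm ki v D S IH])
    show "?\<eta> f = \<gamma> f" if "f \<in> cubes S" "f 0 = 0" for f
      using that S by (simp add: khat_eq[of _ S 0])
  qed (rule Suc.prems(2), simp, simp)+
  also have "(\<lambda>f\<in>cubes S. if f 0 = 1 \<and> f (Suc m) = 1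
    then evl G [?\<eta> (f(Suc m := 0)), \<gamma> (f(Suc m := 0)), ?\<eta> f, \<gamma> f] q else \<gamma> f)
    = restrict (khat G q (Suc m) \<gamma>) (cubes S)"
  proof (rule restrict_ext)
    fix f assume f: "f \<in> cubes S"
    have f0: "f(Suc m := 0) \<in> cubes S" using f S by (simp add: cubes_upd)
    show "(if f 0 = 1 \<and> f (Suc m) = 1
      then evl G [?\<eta> (f(Suc m := 0)), \<gamma> (f(Suc m := 0)), ?\<eta> f, \<gamma> f] q else \<gamma> f) = khat G q (Suc m) \<gamma> f"
    proof (cases "f 0 = 1 \<and> f (Suc m) = 1 \<and> \<not> (\<forall>i\<le>Suc m. f i = 1)")
      \<comment> \<open>The completion also applies \<open>q\<close> at points where some coordinate
        strictly between \<open>0\<close> and \<open>Suc m\<close> is 0. There the previous stage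
        agrees with \<gamma>, and \<open>q(x, x, y, y) = y\<close> returns the value of
        \<gamma>.\<close>
      case True
      then obtain i where i: "i \<le> Suc m" "f i \<noteq> 1" by blast
      then have i': "i \<le> m" "i \<in> S" "f i = 0"
        using True Suc.prems(1) cubes_val[OF f, of i] by (auto simp: le_Suc_eq)
      then have "khat G q m \<gamma> f = \<gamma> f" "khat G q m \<gamma> (f(Suc m := 0)) = \<gamma> (f(Suc m := 0))"
        using khat_eq[OF f i'(2,1)] khat_eq[OF f0 i'(2,1)] i' by auto
      moreover have "\<gamma> f \<in> B" "\<gamma> (f(Suc m := 0)) \<in> B" using g f f0 by auto
      ultimately show ?thesis using True f f0 id by auto
    next
      case False
      show ?thesis
      proof (cases "\<forall>i\<le>Suc m. f i = 1")
        case True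
        then have "f 0 = 1" "f (Suc m) = 1" by auto
        then show ?thesis using True f f0 by simp
      next
        case not_all: False
        then have "\<not> (f 0 = 1 \<and> f (Suc m) = 1)" using False by blast
        then show ?thesis using not_all by (simp only: khat.simps if_False)
      qed
    qed
  qed
  finally show ?case .
qed

section \<open>The terms q_n and colexicographic order\<close>

lemma vars_qterm:
  assumes "vars q \<subseteq> {0..<4}"
  shows "vars (qterm q (Suc (Suc m))) \<subseteq> {..<2 ^ Suc (Suc m)}"
proof (induction m)
  case 0
  then show ?case using assms by (auto simp: eval_nat_numeral)
next
  case (Suc m)
  let ?k = "Suc (Suc m)"
  have "vars (qsub (qterm q ?k) (Var (2 ^ ?k - 1)) (tsubst (\<lambda>j. Var (j + 2 ^ ?k)) (qterm q ?k))
      (Var (2 ^ Suc ?k - 1)) i) \<subseteq> {..<2 ^ Suc ?k}" if "i \<in> vars q" for i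
  proof -
    have "i < 4" using that assms by auto
    have le: "j < 2 ^ Suc ?k" "j + 2 ^ ?k < 2 ^ Suc ?k" if "j \<in> vars (qterm q ?k)" for j
      using Suc that by auto
    have "i = 0 \<or> i = 1 \<or> i = 2 \<or> i = 3" using \<open>i < 4\<close> by arith
    then show ?thesis using le by (auto simp: qsub_def vars_tsubst less_imp_diff_less simp del: qterm.simps)
  qed
  then show ?case unfolding qterm.simps(2)[of q ?k] by (auto simp: vars_tsubst simp del: qterm.simps)
qed

lemma mask_bits: "((2::nat) ^ n - 1) div 2 ^ i mod 2 = (if i < n then 1 else 0)"
  using bit_mask_iff[where 'a = nat, of n i]
  by (auto simp: mask_eq_exp_minus_1 bit_iff_odd odd_iff_mod_2_eq_one)

text \<open>Variable \<open>k\<close> stands for the corner whose coordinates are the binary digits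
  of \<open>k\<close>. In the recursion the top digit is 0 for the first two arguments of
  \<open>q\<close> and 1 for the last two, which matches the update at the new direction.
  Coordinates above \<open>Suc m\<close> stay those of \<open>f\<close>, since the induction applies
  the smaller term to faces of a larger cube.\<close>

lemma khat_eq_qterm:
  assumes q: "vars q \<subseteq> {0..<4}" and f: "\<And>i. i \<le> Suc m \<Longrightarrow> f i = 1"
  shows "khat G q (Suc m) \<gamma> f =
    tev G (\<lambda>k. \<gamma> (\<lambda>i. if i \<le> Suc m then k div 2 ^ i mod 2 else f i)) (qterm q (Suc (Suc m)))"
  using f
proof (induction m arbitrary: f)
  case 0
  have *: "f 0 = 1" "f (Suc 0) = 1" using 0 by auto
  have "[\<gamma> (f(Suc 0 := 0, 0 := 0)), \<gamma> (f(Suc 0 := 0)), \<gamma> (f(0 := 0)), \<gamma> f] ! k =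
      \<gamma> (\<lambda>i. if i \<le> Suc 0 then k div 2 ^ i mod 2 else f i)" if "k \<in> vars q" for k
  proof -
    have "k = 0 \<or> k = 1 \<or> k = 2 \<or> k = 3" using that q by auto
    moreover have "(\<lambda>i. if i \<le> Suc 0 then k div 2 ^ i mod 2 else f i) =
        f(0 := k mod 2, Suc 0 := k div 2 mod 2)" by (auto simp: fun_eq_iff le_Suc_eq)
    ultimately show ?thesis using *
      by (auto simp: fun_upd_idem fun_upd_twist)
  qed
  then show ?case using 0 by (auto simp: evl_def le_Suc_eq intro!: tev_cong)
next
  case (Suc m)
  let ?k = "Suc (Suc m)"
  let ?\<rho> = "\<lambda>k. \<gamma> (\<lambda>i. if i \<le> ?k then k div 2 ^ i mod 2 else f i)"
  let ?\<sigma> = "qsub (qterm q ?k) (Var (2 ^ ?k - 1)) (tsubst (\<lambda>j. Var (j + 2 ^ ?k)) (qterm q ?k))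
      (Var (2 ^ Suc ?k - 1))"
  have lt: "j < 2 ^ ?k" if "j \<in> vars (qterm q ?k)" for j using vars_qterm[OF q, of m] that by blast
  have "khat G q (Suc m) \<gamma> (f(?k := 0)) = tev G ?\<rho> (qterm q ?k)"
    using Suc.prems by (subst Suc.IH) (auto intro!: tev_cong arg_cong[of _ _ \<gamma>] dest!: lt simp: fun_eq_iff le_Suc_eq simp del: qterm.simps)
  moreover have "khat G q (Suc m) \<gamma> f = tev G ?\<rho> (tsubst (\<lambda>j. Var (j + 2 ^ ?k)) (qterm q ?k))"
  proof -
    have bits: "(j + 2 ^ ?k) div 2 ^ i mod 2 = (if i = ?k then 1 else j div 2 ^ i mod 2)"
      if "j < 2 ^ ?k" "i \<le> ?k" for i j :: nat
    proof (cases "i = ?k")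
      case True
      then show ?thesis using that by (simp add: div_add_self2 del: power_Suc)
    next
      case False
      then have eq: "2 ^ ?k = (2::nat) ^ i * (2 * 2 ^ (?k - i - 1))"
        using that by (simp flip: power_Suc power_add)
      have "(j + 2 ^ ?k) div 2 ^ i = 2 * 2 ^ (?k - i - 1) + j div 2 ^ i"
        unfolding eq by (rule div_mult_self2) simp
      then show ?thesis using False by (simp del: power_Suc)
    qed
    show ?thesis using Suc.prems
      by (subst Suc.IH) (auto simp: tev_tsubst bits lt fun_eq_iff le_Suc_eq simp del: qterm.simps power_Suc
        intro!: tev_cong arg_cong[of _ _ \<gamma>])
  qed
  \<comment> \<open>The number \<open>2 ^ ?k - 1\<close> has digit 1 below position
    \<open>?k\<close> and digit 0 there: it encodes the top corner of the lower face.\<close>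
  moreover have "\<gamma> (f(?k := 0)) = ?\<rho> (2 ^ ?k - 1)"
    using Suc.prems by (auto simp: fun_eq_iff mask_bits[unfolded One_nat_def] simp del: power_Suc intro!: arg_cong[of _ _ \<gamma>])
  moreover have "\<gamma> f = ?\<rho> (2 ^ Suc ?k - 1)"
    using Suc.prems by (auto simp: fun_eq_iff mask_bits[unfolded One_nat_def] simp del: power_Suc intro!: arg_cong[of _ _ \<gamma>])
  ultimately have "khat G q ?k \<gamma> f = evl G [tev G ?\<rho> (?\<sigma> 0), tev G ?\<rho> (?\<sigma> 1), tev G ?\<rho> (?\<sigma> 2), tev G ?\<rho> (?\<sigma> 3)] q"
    using Suc.prems by (simp add: qsub_def del: qterm.simps khat.simps power_Suc One_nat_def add: khat.simps(2)[of G q "Suc m"])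
  also have "\<dots> = tev G (\<lambda>i. tev G ?\<rho> (?\<sigma> i)) q"
    unfolding evl_def
  proof (rule tev_cong)
    fix i assume "i \<in> vars q"
    then have "i = 0 \<or> i = 1 \<or> i = 2 \<or> i = 3" using q by auto
    then show "[tev G ?\<rho> (?\<sigma> 0), tev G ?\<rho> (?\<sigma> 1), tev G ?\<rho> (?\<sigma> 2), tev G ?\<rho> (?\<sigma> 3)] ! i = tev G ?\<rho> (?\<sigma> i)"
      by (auto simp: eval_nat_numeral simp del: qterm.simps)
  qed
  also have "\<dots> = tev G ?\<rho> (qterm q (Suc ?k))"
    unfolding qterm.simps(2)[of q ?k] by (simp add: tev_tsubst del: qterm.simps)
  finally show ?case .
qed

text \<open>With all directions of the cube in use, the only corner where \<open>khat\<close>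
  applies the term is \<open>one_c\<close>; outside \<open>cubes\<close> both sides are
  undefined.\<close>

lemma hat_eq_khat:
  assumes q: "vars q \<subseteq> {0..<4}" and g: "\<gamma> \<in> cubes {0..<Suc (Suc m)} \<rightarrow>\<^sub>E B"
  shows "hat G q (Suc (Suc m)) \<gamma> = restrict (khat G q (Suc m) \<gamma>) (cubes {0..<Suc (Suc m)})"
proof
  let ?n = "Suc (Suc m)"
  fix f
  have one: "one_c ?n \<in> cubes {0..<?n}" by (auto simp: one_c_def cubes_def)
  show "hat G q ?n \<gamma> f = restrict (khat G q (Suc m) \<gamma>) (cubes {0..<?n}) f"
  proof (cases "f = one_c ?n")
    case True
    have "khat G q (Suc m) \<gamma> f =
        tev G (\<lambda>k. \<gamma> (\<lambda>i. if i \<le> Suc m then k div 2 ^ i mod 2 else f i)) (qterm q ?n)"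
      using True by (intro khat_eq_qterm[OF q]) (auto simp: one_c_def)
    also have "\<dots> = evl G (map (\<lambda>m. \<gamma> (fcolex ?n m)) [0..<2 ^ ?n]) (qterm q ?n)"
      unfolding evl_def
    proof (rule tev_cong)
      fix k assume "k \<in> vars (qterm q ?n)"
      then have k: "k < 2 ^ ?n" using vars_qterm[OF q, of m] by blast
      have "(\<lambda>i. if i \<le> Suc m then k div 2 ^ i mod 2 else f i) = fcolex ?n k"
        using True by (auto simp: fcolex_def one_c_def fun_eq_iff)
      then show "\<gamma> (\<lambda>i. if i \<le> Suc m then k div 2 ^ i mod 2 else f i) =
          map (\<lambda>m. \<gamma> (fcolex ?n m)) [0..<2 ^ ?n] ! k" using k by (simp del: power_Suc)
    qed
    finally show ?thesis using True one by (simp add: hat_def)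
  next
    case False
    show ?thesis
    proof (cases "f \<in> cubes {0..<?n}")
      case True
      have "\<exists>i<?n. f i \<noteq> 1"
      proof (rule ccontr)
        assume "\<not> ?thesis"
        then have "f = one_c ?n" using True
          by (auto simp: fun_eq_iff one_c_def cubes_def PiE_iff extensional_def)
        then show False using False by simp
      qed
      then obtain i where i: "i < ?n" "f i \<noteq> 1" by blast
      then have "f i = 0" using cubes_val[OF True, of i] by auto
      then have "khat G q (Suc m) \<gamma> f = \<gamma> f" using i by (intro khat_eq[OF True, of i]) auto
      then show ?thesis using False True by (simp add: hat_def)
    next
      case out: False
      then show ?thesis using False g by (auto simp: hat_def PiE_iff extensional_def)
    qed
  qed
qed

theorem theorem3p5:
  fixes ar :: "'f \<Rightarrow> nat" and E :: "('f trm \<times> 'f trm) set" and q2 :: "'f trm"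
    and A :: "'a set" and G :: "'f \<Rightarrow> 'a list \<Rightarrow> 'a"
    and n :: nat and \<theta> :: "nat \<Rightarrow> 'a rel" and \<gamma> :: "(nat \<Rightarrow> nat) \<Rightarrow> 'a"
  assumes CM1: "cong_modular_var ar E TYPE('a)"
    and CM2: "cong_modular_var ar E TYPE((nat \<Rightarrow> nat) \<Rightarrow> 'a)"
    and K1: "kiss_term ar E q2 TYPE('a)"
    and K2: "kiss_term ar E q2 TYPE((nat \<Rightarrow> nat) \<Rightarrow> 'a)"
    and AV: "in_variety ar E A G"
    and n: "n \<ge> 2"
    and th: "\<forall>k<n. is_con ar A G (\<theta> k)"
    and g: "\<gamma> \<in> cubes {0..<n} \<rightarrow>\<^sub>E A"
    and faces: "\<forall>i<n. \<forall>j\<in>{0, 1}. face {0..<n} i j \<gamma> \<in> Delta ar A G ({0..<n} - {i}) \<theta>"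
  shows "hat G q2 n \<gamma> \<in> Delta ar A G {0..<n} \<theta>"
proof -
  obtain m where m: "n = Suc (Suc m)" using n by (metis add_2_eq_Suc le_Suc_ex)
  have q: "vars q2 \<subseteq> {0..<4}" using K1 by (simp add: kiss_term_def)
  have alg: "is_alg ar A G" using AV by (simp add: in_variety_def)
  have sub: "\<theta> k \<subseteq> A \<times> A" if "k \<in> {0..<n}" for k using th that by (auto simp: is_con_def equiv_def)
  have id: "evl G [x, x, y, y] q2 = y" if "x \<in> A" "y \<in> A" for x y
    using K1 AV that unfolding kiss_term_def by blast
  \<comment> \<open>Stage \<open>Suc m\<close> of \<open>khat\<close> uses the directions
    \<open>0\<close> to \<open>Suc m\<close>, which are all \<open>n\<close> directions.\<close>
  have "restrict (khat G q2 (Suc m) \<gamma>) (cubes {0..<n}) \<in> Delta ar A G {0..<n} \<theta>"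
  proof (rule khat_in_dimcon[OF CM2 K2 id AV dimcon_Delta[OF alg sub] _ g])
    fix i j :: nat assume "i \<le> Suc m" "j \<in> {0, 1}"
    then show "(\<lambda>f\<in>cubes {0..<n}. \<gamma> (f(i := j))) \<in> Delta ar A G {0..<n} \<theta>"
      using faces m by (intro Delta_face[OF alg sub]) auto
  qed (use m in auto)
  then show ?thesis using hat_eq_khat[OF q g[unfolded m]] m by simp
qed

end
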